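(* Assume A1–A5 (stated in the context). Let the sequence of alternatives $f_n$ be consistent. Then for any inconsistent sequence of alternatives $f_{1n}$ and for tests $K_n$ generated by the test statistics $T_n$ with $\alpha(K_n)=\alpha(1+o(1))$, $0<\alpha<1$, $$\lim_{n\to\infty}\bigl(\beta(K_n,f_n)-\beta(K_n,f_n+f_{1n})\bigr)=0 .$$
   Context: Setting. Fix $0<r<1/2$ and $\sigma>0$. One observes $dY_n(t)=f(t)\,dt+\frac{\sigma}{\sqrt n}\,dw(t)$, $t\in[0,1]$, with unknown signal $f\in L_2(0,1)$ and Gaussian white noise $dw$. Let $(\phi_j)_{j\ge1}$ be an orthonormal basis of $L_2(0,1)$; then $y_j=\int_0^1\phi_j\,dY_n=\theta_j+\frac{\sigma}{\sqrt n}\xi_j$ with $\theta_j=\int_0^1f\phi_j\,dt$ and $\xi_j$ i.i.d. standard Gaussian. The hypothesis is $f=0$; alternatives are sequences $f=f_n\in L_2(0,1)$. The test statistics are $$T_n=\sum_{j=1}^\infty\kappa_{nj}^2y_j^2-\sigma^2n^{-1}\rho_n,\qquad \rho_n=\sum_{j=1}^\infty\kappa_{nj}^2 .$$ Assumptions on the coefficients. $[\cdot]$ is the integer part; $a_n\asymp b_n$ means that $a_n/b_n$ is bounded between two positive constants. A1: for each $n$ the sequence $\kappa_{nj}^2$, $j\ge1$, is decreasing. A2: there are positive constants $C_1,C_2$ such that $C_1<A_n=\sigma^{-4}n^2\sum_{j=1}^\infty\kappa_{nj}^4<C_2$ for each $n$. A3: there are positive constants $c_1,c_2$ such that $c_1n^{-2r}\le\rho_n\le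 c_2n^{-2r}$. Put $k_n=\sup\{k:\sum_{j<k}\kappa_{nj}^2\le\frac12\rho_n\}$ and $\kappa_n^2=\kappa_{nk_n}^2$. A4: there are $C_1$ and $\lambda>1$ such that $\kappa^2_{n,[(1+\delta)k_n]}<C_1(1+\delta)^{-\lambda}\kappa_n^2$ for any $\delta>0$ and each $n$. A5: $\kappa_{n1}^2\asymp\kappa_n^2$ as $n\to\infty$, and for any $c>1$ there is $C>0$ such that $\kappa_{n,[ck_n]}^2\ge C\kappa_n^2$ for all $n$. Tests. A test $K_n$ generated by $T_n$ rejects the hypothesis when $T_n$ exceeds a threshold; $\alpha(K_n)$ is its type I error probability and $\beta(K_n,f)$ its type II error probability at $f$. A sequence $f_n$ is consistent if for any $\alpha\in(0,1)$, for tests $K_n$ generated by $T_n$ with $\alpha(K_n)=\alpha(1+o(1))$, one has $\limsup_{n\to\infty}\beta(K_n,f_n)<1-\alpha$. It is inconsistent if for each sequence of tests $K_n$ generated by $T_n$ one has $\liminf_{n\to\infty}(\alpha(K_n)+\beta(K_n,f_n))\ge1$. *)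

theory Defs
  imports "HOL-Probability.Probability" "HOL-Library.Landau_Symbols"
begin

text \<open>
  Elements of \<open>L\<^sub>2(0,1)\<close> are represented by square integrable functions; equality in
  \<open>L\<^sub>2(0,1)\<close> is equality almost everywhere.
\<close>

definition square_integrable :: "(real \<Rightarrow> real) set" where
  "square_integrable =
     {f \<in> borel_measurable (lebesgue_on {0<..<1}).
        integrable (lebesgue_on {0<..<1}) (\<lambda>t. (f t)\<^sup>2)}"

definition L2_inner :: "(real \<Rightarrow> real) \<Rightarrow> (real \<Rightarrow> real) \<Rightarrow> real" where
  "L2_inner f g = (LINT t|lebesgue_on {0<..<1}. f t * g t)"

definition L2_norm :: "(real \<Rightarrow> real) \<Rightarrow> real" where
  "L2_norm f = sqrt (L2_inner f f)"

text \<open>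
  All sequences and coefficient arrays are indexed by \<open>j \<ge> 1\<close> and sample sizes by \<open>n \<ge> 1\<close>;
  values at index \<open>0\<close> are never constrained.
\<close>

definition orthonormal :: "(nat \<Rightarrow> real \<Rightarrow> real) \<Rightarrow> bool" where
  "orthonormal e \<longleftrightarrow>
     (\<forall>j\<ge>1. e j \<in> square_integrable) \<and>
     (\<forall>i\<ge>1. \<forall>j\<ge>1. L2_inner (e i) (e j) = (if i = j then 1 else 0))"

definition orthonormal_basis :: "(nat \<Rightarrow> real \<Rightarrow> real) \<Rightarrow> bool" where
  "orthonormal_basis \<phi> \<longleftrightarrow>
     orthonormal \<phi> \<and>
     (\<forall>f\<in>square_integrable.
        (\<lambda>N. L2_norm (\<lambda>t. f t - (\<Sum>j=1..N. L2_inner f (\<phi> j) * \<phi> j t))) \<longlonglongrightarrow> 0)"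

text \<open>
  Gaussian white noise on \<open>(0,1)\<close> as an isonormal process: \<open>W h\<close> stands for the stochastic
  integral \<open>\<integral> h dw\<close>.  It is linear in \<open>h\<close> up to null sets, \<open>W h\<close> has law
  \<open>N(0, \<parallel>h\<parallel>\<^sup>2)\<close> (the Dirac measure at \<open>0\<close> if \<open>\<parallel>h\<parallel> = 0\<close>), and joint Gaussianity is expressed
  by the independence of the integrals of orthonormal functions.
\<close>

definition gaussian_white_noise :: "'a measure \<Rightarrow> ((real \<Rightarrow> real) \<Rightarrow> 'a \<Rightarrow> real) \<Rightarrow> bool" where
  "gaussian_white_noise M W \<longleftrightarrow>
     prob_space M \<and>
     (\<forall>h\<in>square_integrable. W h \<in> borel_measurable M) \<and>
     (\<forall>g\<in>square_integrable. \<forall>h\<in>square_integrable. \<forall>a b.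
        AE \<omega> in M. W (\<lambda>t. a * g t + b * h t) \<omega> = a * W g \<omega> + b * W h \<omega>) \<and>
     (\<forall>h\<in>square_integrable. L2_norm h = 0 \<longrightarrow> (AE \<omega> in M. W h \<omega> = 0)) \<and>
     (\<forall>h\<in>square_integrable. L2_norm h > 0 \<longrightarrow>
        distributed M lborel (W h) (normal_density 0 (L2_norm h))) \<and>
     (\<forall>e. orthonormal e \<longrightarrow>
        prob_space.indep_vars M (\<lambda>_. borel) (\<lambda>j. W (e j)) {1..})"

text \<open>
  \<open>Y_int W \<sigma> n f h\<close> is \<open>\<integral> h dY\<^sub>n\<close> for \<open>dY\<^sub>n(t) = f(t) dt + (\<sigma> / \<surd>n) dw(t)\<close>.
\<close>

definition Y_int ::
  "((real \<Rightarrow> real) \<Rightarrow> 'a \<Rightarrow> real) \<Rightarrow> real \<Rightarrow> nat \<Rightarrow> (real \<Rightarrow> real) \<Rightarrow> (real \<Rightarrow> real) \<Rightarrow> 'a \<Rightarrow> real"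
where
  "Y_int W \<sigma> n f h \<omega> = L2_inner h f + \<sigma> / sqrt (real n) * W h \<omega>"

definition rho :: "(nat \<Rightarrow> nat \<Rightarrow> real) \<Rightarrow> nat \<Rightarrow> real" where
  "rho \<kappa> n = (\<Sum>j. (\<kappa> n (Suc j))\<^sup>2)"

text \<open>
  The statistic \<open>T\<^sub>n\<close> as a function of the coordinates \<open>y\<^sub>j = \<integral> \<phi>\<^sub>j dY\<^sub>n\<close>.
\<close>

definition T_stat :: "(nat \<Rightarrow> nat \<Rightarrow> real) \<Rightarrow> real \<Rightarrow> nat \<Rightarrow> (nat \<Rightarrow> real) \<Rightarrow> real" where
  "T_stat \<kappa> \<sigma> n y =
     (\<Sum>j. (\<kappa> n (Suc j))\<^sup>2 * (y (Suc j))\<^sup>2) - \<sigma>\<^sup>2 / real n * rho \<kappa> n"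

text \<open>A test generated by \<open>T\<^sub>n\<close> is given by its threshold \<open>c\<close>: it rejects iff \<open>T\<^sub>n > c\<close>.\<close>

definition type_I_error ::
  "'a measure \<Rightarrow> ((real \<Rightarrow> real) \<Rightarrow> 'a \<Rightarrow> real) \<Rightarrow> (nat \<Rightarrow> real \<Rightarrow> real) \<Rightarrow>
   (nat \<Rightarrow> nat \<Rightarrow> real) \<Rightarrow> real \<Rightarrow> nat \<Rightarrow> real \<Rightarrow> real"
where
  "type_I_error M W \<phi> \<kappa> \<sigma> n c =
     measure M {\<omega> \<in> space M. T_stat \<kappa> \<sigma> n (\<lambda>j. Y_int W \<sigma> n (\<lambda>_. 0) (\<phi> j) \<omega>) > c}"

definition type_II_error ::
  "'a measure \<Rightarrow> ((real \<Rightarrow> real) \<Rightarrow> 'a \<Rightarrow> real) \<Rightarrow> (nat \<Rightarrow> real \<Rightarrow> real) \<Rightarrow>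
   (nat \<Rightarrow> nat \<Rightarrow> real) \<Rightarrow> real \<Rightarrow> nat \<Rightarrow> real \<Rightarrow> (real \<Rightarrow> real) \<Rightarrow> real"
where
  "type_II_error M W \<phi> \<kappa> \<sigma> n c f =
     measure M {\<omega> \<in> space M. T_stat \<kappa> \<sigma> n (\<lambda>j. Y_int W \<sigma> n f (\<phi> j) \<omega>) \<le> c}"

text \<open>The relation \<open>\<alpha>(K\<^sub>n) = \<alpha> (1 + o(1))\<close> for the tests with thresholds \<open>c n\<close>.\<close>

definition asymptotic_level ::
  "'a measure \<Rightarrow> ((real \<Rightarrow> real) \<Rightarrow> 'a \<Rightarrow> real) \<Rightarrow> (nat \<Rightarrow> real \<Rightarrow> real) \<Rightarrow>
   (nat \<Rightarrow> nat \<Rightarrow> real) \<Rightarrow> real \<Rightarrow> (nat \<Rightarrow> real) \<Rightarrow> real \<Rightarrow> bool"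
where
  "asymptotic_level M W \<phi> \<kappa> \<sigma> c \<alpha> \<longleftrightarrow>
     (\<lambda>n. type_I_error M W \<phi> \<kappa> \<sigma> n (c n)) \<sim>[sequentially] (\<lambda>_. \<alpha>)"

definition consistent ::
  "'a measure \<Rightarrow> ((real \<Rightarrow> real) \<Rightarrow> 'a \<Rightarrow> real) \<Rightarrow> (nat \<Rightarrow> real \<Rightarrow> real) \<Rightarrow>
   (nat \<Rightarrow> nat \<Rightarrow> real) \<Rightarrow> real \<Rightarrow> (nat \<Rightarrow> real \<Rightarrow> real) \<Rightarrow> bool"
where
  "consistent M W \<phi> \<kappa> \<sigma> f \<longleftrightarrow>
     (\<forall>\<alpha>. 0 < \<alpha> \<and> \<alpha> < 1 \<longrightarrow>
        (\<forall>c. asymptotic_level M W \<phi> \<kappa> \<sigma> c \<alpha> \<longrightarrow>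
           limsup (\<lambda>n. ereal (type_II_error M W \<phi> \<kappa> \<sigma> n (c n) (f n))) < ereal (1 - \<alpha>)))"

definition inconsistent ::
  "'a measure \<Rightarrow> ((real \<Rightarrow> real) \<Rightarrow> 'a \<Rightarrow> real) \<Rightarrow> (nat \<Rightarrow> real \<Rightarrow> real) \<Rightarrow>
   (nat \<Rightarrow> nat \<Rightarrow> real) \<Rightarrow> real \<Rightarrow> (nat \<Rightarrow> real \<Rightarrow> real) \<Rightarrow> bool"
where
  "inconsistent M W \<phi> \<kappa> \<sigma> f \<longleftrightarrow>
     (\<forall>c. liminf (\<lambda>n. ereal (type_I_error M W \<phi> \<kappa> \<sigma> n (c n)
                            + type_II_error M W \<phi> \<kappa> \<sigma> n (c n) (f n))) \<ge> 1)"

definition k_cut :: "(nat \<Rightarrow> nat \<Rightarrow> real) \<Rightarrow> nat \<Rightarrow> nat" where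
  "k_cut \<kappa> n = Sup {k. 1 \<le> k \<and> (\<Sum>j=1..<k. (\<kappa> n j)\<^sup>2) \<le> rho \<kappa> n / 2}"

definition kappa_sq :: "(nat \<Rightarrow> nat \<Rightarrow> real) \<Rightarrow> nat \<Rightarrow> real" where
  "kappa_sq \<kappa> n = (\<kappa> n (k_cut \<kappa> n))\<^sup>2"

definition assumption_A1 :: "(nat \<Rightarrow> nat \<Rightarrow> real) \<Rightarrow> bool" where
  "assumption_A1 \<kappa> \<longleftrightarrow> (\<forall>n\<ge>1. \<forall>i j. 1 \<le> i \<and> i \<le> j \<longrightarrow> (\<kappa> n j)\<^sup>2 \<le> (\<kappa> n i)\<^sup>2)"

text \<open>
  In the next two definitions the summability required for the series to be finite is stated
  explicitly, since \<open>suminf\<close> has no meaningful value on divergent series.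
\<close>

definition assumption_A2 :: "real \<Rightarrow> (nat \<Rightarrow> nat \<Rightarrow> real) \<Rightarrow> bool" where
  "assumption_A2 \<sigma> \<kappa> \<longleftrightarrow>
     (\<exists>C1>0. \<exists>C2>0. \<forall>n\<ge>1.
        summable (\<lambda>j. \<kappa> n (Suc j) ^ 4) \<and>
        C1 < (real n)\<^sup>2 / \<sigma> ^ 4 * (\<Sum>j. \<kappa> n (Suc j) ^ 4) \<and>
        (real n)\<^sup>2 / \<sigma> ^ 4 * (\<Sum>j. \<kappa> n (Suc j) ^ 4) < C2)"

definition assumption_A3 :: "real \<Rightarrow> (nat \<Rightarrow> nat \<Rightarrow> real) \<Rightarrow> bool" where
  "assumption_A3 r \<kappa> \<longleftrightarrow>
     (\<exists>c1>0. \<exists>c2>0. \<forall>n\<ge>1.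
        summable (\<lambda>j. (\<kappa> n (Suc j))\<^sup>2) \<and>
        c1 * real n powr (-2 * r) \<le> rho \<kappa> n \<and>
        rho \<kappa> n \<le> c2 * real n powr (-2 * r))"

definition assumption_A4 :: "(nat \<Rightarrow> nat \<Rightarrow> real) \<Rightarrow> bool" where
  "assumption_A4 \<kappa> \<longleftrightarrow>
     (\<exists>C1. \<exists>lam>1. \<forall>\<delta>>0. \<forall>n\<ge>1.
        (\<kappa> n (nat \<lfloor>(1 + \<delta>) * real (k_cut \<kappa> n)\<rfloor>))\<^sup>2
          < C1 * (1 + \<delta>) powr (- lam) * kappa_sq \<kappa> n)"

definition assumption_A5 :: "(nat \<Rightarrow> nat \<Rightarrow> real) \<Rightarrow> bool" where
  "assumption_A5 \<kappa> \<longleftrightarrow>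
     (\<lambda>n. (\<kappa> n 1)\<^sup>2) \<in> \<Theta>[sequentially](\<lambda>n. kappa_sq \<kappa> n) \<and>
     (\<forall>c>1. \<exists>C>0. \<forall>n\<ge>1.
        (\<kappa> n (nat \<lfloor>c * real (k_cut \<kappa> n)\<rfloor>))\<^sup>2 \<ge> C * kappa_sq \<kappa> n)"

end

theory Submission imports Defs begin

text \<open>
  Put \<open>a\<^sub>j = n \<kappa>\<^sub>n\<^sub>j\<^sup>2 / \<sigma>\<^sup>2\<close> and \<open>\<mu>\<^sub>j = \<surd>n \<theta>\<^sub>j / \<sigma>\<close>.  Then \<open>n\<^sup>2 / \<sigma>\<^sup>4\<close> times the statistic is \<open>Q(\<mu>) - \<Sum> a\<^sub>j\<close>,
  where \<open>Q(\<mu>) = \<Sum> a\<^sub>j (\<xi>\<^sub>j + \<mu>\<^sub>j)\<^sup>2\<close> is a weighted sum of noncentral chi-square variables, and A2 says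
  that \<open>\<Sum> a\<^sub>j\<^sup>2\<close> lies between two positive constants.  Let \<open>R(\<mu>) = \<Sum> a\<^sub>j \<mu>\<^sub>j\<^sup>2\<close> be the size of the
  signal: \<open>Q(\<mu>) - \<Sum> a\<^sub>j\<close> has mean \<open>R(\<mu>)\<close>, and its variance is at most a constant times \<open>1 + R(\<mu>)\<close>.

  An inconsistent sequence \<open>\<nu>\<close> has \<open>R(\<nu>) \<longlonglongrightarrow> 0\<close>.  Inconsistency for every choice of thresholds says
  that the distribution function of \<open>Q(0)\<close> exceeds that of \<open>Q(\<nu>)\<close> by at most some \<open>\<eta>\<^sub>n \<longlonglongrightarrow> 0\<close>, uniformly
  in the argument.  Integrating this inequality over a window bounds the difference \<open>R(\<nu>)\<close> of the
  means; the part outside of the window is controlled by second moments.  The result is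
  \<open>R(\<nu>)\<^sup>2 \<le> const \<sqdot> \<eta>\<^sub>n\<close> (\<open>expectation_diff_le_of_cdf_diff_le\<close>, \<open>signal_sq_le_of_cdf_diff_le\<close>).

  Now let a signal \<open>\<mu>\<close> be perturbed by \<open>\<nu>\<close> with \<open>R(\<nu>) \<longlonglongrightarrow> 0\<close>.  The difference \<open>Q(\<mu> + \<nu>) - Q(\<mu>)\<close> is a
  centred Gaussian variable of variance \<open>O(R(\<nu>))\<close> plus a constant which is small as long as \<open>R(\<mu>)\<close>
  stays bounded.  In that case the type II error can change only if \<open>Q(\<mu>)\<close> falls close to the
  threshold, and the probability of this is small by anticoncentration, uniformly in the threshold and
  in \<open>\<mu>\<close> (\<open>prob_chi_sq_interval_le\<close>).  If \<open>R(\<mu>)\<close> is large, so is \<open>R(\<mu> + \<nu>)\<close>; since a positive asymptotic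
  level keeps the thresholds bounded above, both type II errors are then small by Chebyshev's
  inequality (\<open>prob_chi_sq_lower_tail\<close>).

  Anticoncentration holds because the characteristic function of \<open>Q(\<mu>)\<close> is bounded by
  \<open>(1 + 4 t\<^sup>2 \<Sum> a\<^sub>j\<^sup>2)\<^sup>-\<^sup>1\<^sup>/\<^sup>4\<close> whatever \<open>\<mu>\<close> is (\<open>cmod_char_chi_sq_le\<close>).  Each summand
  contributes a factor that can be computed by a one-dimensional Gaussian integral
  (\<open>cmod_integral_iexp_shifted_square\<close>), and a bound on the characteristic function limits the mass
  of short intervals (\<open>measure_interval_le_of_char_decay\<close>).
\<close>

section \<open>Anticoncentration from decay of the characteristic function\<close>

text \<open>
  For independent standard normal \<open>x = y + w\<close> and \<open>y\<close>, this factors the joint density into the density of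
  the difference \<open>w\<close> and the conditional density of \<open>y\<close> given \<open>w\<close>.
\<close>

lemma std_normal_density_mult_shift:
  "std_normal_density (y + w) * std_normal_density y
     = normal_density 0 (sqrt 2) w * normal_density (- w / 2) (1 / sqrt 2) y"
proof -
  have "- (y + w)\<^sup>2 / 2 + - y\<^sup>2 / 2 = - (w - 0)\<^sup>2 / (2 * (sqrt 2)\<^sup>2) + - (y - - w / 2)\<^sup>2 / (2 * (1 / sqrt 2)\<^sup>2)"
    by (simp add: power2_eq_square field_simps)
  moreover have "1 / sqrt (2 * pi) * (1 / sqrt (2 * pi))
      = 1 / sqrt (2 * pi * (sqrt 2)\<^sup>2) * (1 / sqrt (2 * pi * (1 / sqrt 2)\<^sup>2))"
    by (simp add: power_divide real_sqrt_mult field_simps)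
  ultimately have "(1 / sqrt (2 * pi) * (1 / sqrt (2 * pi))) * exp (- (y + w)\<^sup>2 / 2 + - y\<^sup>2 / 2)
      = (1 / sqrt (2 * pi * (sqrt 2)\<^sup>2) * (1 / sqrt (2 * pi * (1 / sqrt 2)\<^sup>2)))
        * exp (- (w - 0)\<^sup>2 / (2 * (sqrt 2)\<^sup>2) + - (y - - w / 2)\<^sup>2 / (2 * (1 / sqrt 2)\<^sup>2))"
    by (simp only:)
  then show ?thesis
    unfolding std_normal_density_def exp_add unfolding normal_density_def by (simp only: mult_ac)
qed

lemma lborel_integral_shift_scale:
  fixes g :: "real \<Rightarrow> complex"
  assumes "c > 0"
  shows "(LINT x|lborel. normal_density t c x *\<^sub>R g x) = (LINT z|lborel. std_normal_density z *\<^sub>R g (t + c * z))"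
proof -
  have "normal_density t c (t + c * z) * c = std_normal_density z" for z
    using assms by (simp add: normal_density_def real_sqrt_mult power_mult_distrib field_simps)
  then show ?thesis
    using assms by (subst lborel_integral_real_affine[where c=c and t=t])
      (simp_all add: integral_scaleR_right[symmetric] mult.commute del: integral_scaleR_right)
qed

text \<open>
  The constant is the value of the Gaussian integral that closes the proof of
  \<open>cmod_integral_iexp_shifted_square\<close>.
\<close>

lemma normal_density_mult_gauss:
  "normal_density 0 (sqrt 2) w * exp (- (a\<^sup>2 * w\<^sup>2))
     = 1 / sqrt (1 + 4 * a\<^sup>2) * normal_density 0 (sqrt (2 / (1 + 4 * a\<^sup>2))) w"
proof -
  have pos: "1 + 4 * a\<^sup>2 > 0" by (rule add_pos_nonneg) auto
  have "- (w - 0)\<^sup>2 / (2 * (sqrt 2)\<^sup>2) + - (a\<^sup>2 * w\<^sup>2) = - (w - 0)\<^sup>2 / (2 * (sqrt (2 / (1 + 4 * a\<^sup>2)))\<^sup>2)"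
    using pos by (simp add: field_simps)
  moreover have "1 / sqrt (2 * pi * (sqrt 2)\<^sup>2)
      = 1 / sqrt (1 + 4 * a\<^sup>2) * (1 / sqrt (2 * pi * (sqrt (2 / (1 + 4 * a\<^sup>2)))\<^sup>2))"
    using pos by (simp add: real_sqrt_mult real_sqrt_divide)
  ultimately show ?thesis
    unfolding normal_density_def
    by (simp only: exp_add[symmetric] mult.assoc)
qed

lemma cmod_normal_density_iexp_linear:
  assumes "c > 0"
  shows "cmod (LINT y|lborel. normal_density t c y *\<^sub>R iexp (p * y + q)) = exp (- (p * c)\<^sup>2 / 2)"
proof -
  have "(LINT y|lborel. normal_density t c y *\<^sub>R iexp (p * y + q))
      = (LINT z|lborel. std_normal_density z *\<^sub>R iexp (p * (t + c * z) + q))"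
    by (rule lborel_integral_shift_scale[OF assms])
  also have "\<dots> = (LINT z|lborel. iexp (p * t + q) * (std_normal_density z *\<^sub>R iexp ((p * c) * z)))"
    by (rule Bochner_Integration.integral_cong) (simp_all add: exp_add[symmetric] algebra_simps)
  also have "\<dots> = iexp (p * t + q) * (LINT z|lborel. std_normal_density z *\<^sub>R iexp ((p * c) * z))"
    by (rule integral_mult_right_zero)
  also have "(LINT z|lborel. std_normal_density z *\<^sub>R iexp ((p * c) * z)) = char std_normal_distribution (p * c)"
    unfolding char_def by (subst integral_density) auto
  finally show ?thesis
    by (simp add: char_std_normal_distribution norm_mult del: of_real_mult of_real_add)
qed

text \<open>
  The squared modulus is a double integral of \<open>exp (\<i> a ((x + m)\<^sup>2 - (y + m)\<^sup>2))\<close>.  Substituting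
  \<open>x = y + w\<close> makes the exponent linear in \<open>y\<close>; the integral over \<open>y\<close> is then, up to the density of \<open>w\<close>
  and a factor of modulus 1, the value \<open>exp (- a\<^sup>2 w\<^sup>2)\<close> of a normal characteristic function.  The shift \<open>m\<close> enters only
  through the factor of modulus 1, which is why the bound does not depend on it.
\<close>

lemma cmod_integral_iexp_shifted_square:
  "(cmod (CLINT x|std_normal_distribution. iexp (a * (x + m)\<^sup>2)))\<^sup>2 \<le> 1 / sqrt (1 + 4 * a\<^sup>2)"
proof -
  define e where "e x = iexp (a * (x + m)\<^sup>2)" for x
  have [measurable]: "e \<in> borel_measurable borel" unfolding e_def by measurable
  have [measurable]: "cnj \<in> borel_measurable borel"
    by (intro borel_measurable_continuous_onI continuous_intros)
  have [simp]: "cmod (e x) = 1" for x by (simp add: e_def del: of_real_mult of_real_power of_real_add)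
  define I where "I = (LINT x|lborel. std_normal_density x *\<^sub>R e x)"
  define G where "G = (\<lambda>(w, y). (std_normal_density (y + w) * std_normal_density y) *\<^sub>R (e (y + w) * cnj (e y)))"
  have int: "integrable (lborel \<Otimes>\<^sub>M lborel) G"
  proof (rule lborel_pair.Fubini_integrable)
    show "G \<in> borel_measurable (lborel \<Otimes>\<^sub>M lborel)" unfolding G_def by measurable
    show "AE w in lborel. integrable lborel (\<lambda>y. G (w, y))"
    proof (rule AE_I2)
      fix w :: real
      show "integrable lborel (\<lambda>y. G (w, y))"
        by (rule Bochner_Integration.integrable_bound[where
              f="\<lambda>y. normal_density 0 (sqrt 2) w * normal_density (- w / 2) (1 / sqrt 2) y"])
          (auto simp: G_def norm_mult std_normal_density_mult_shift)
    qed
    have "(LINT y|lborel. cmod (G (w, y))) = normal_density 0 (sqrt 2) w" for w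
      by (simp add: G_def norm_mult std_normal_density_mult_shift abs_mult)
    then show "integrable lborel (\<lambda>w. LINT y|lborel. cmod (G (w, y)))" by simp
  qed
  have "cnj I = (LINT y|lborel. std_normal_density y *\<^sub>R cnj (e y))"
    using Bochner_Integration.integral_cnj[of lborel "\<lambda>y. std_normal_density y *\<^sub>R e y"] by (simp add: I_def)
  then have "I * cnj I = (LINT y|lborel. I * (std_normal_density y *\<^sub>R cnj (e y)))"
    by (simp only: integral_mult_right_zero)
  also have "\<dots> = (LINT y|lborel. LINT w|lborel. G (w, y))"
  proof (rule Bochner_Integration.integral_cong[OF refl])
    fix y :: real
    have "I = (LINT w|lborel. std_normal_density (y + w) *\<^sub>R e (y + w))"
      unfolding I_def by (subst lborel_integral_real_affine[where c=1 and t=y]) auto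
    then have "I * (std_normal_density y *\<^sub>R cnj (e y))
        = (LINT w|lborel. (std_normal_density (y + w) *\<^sub>R e (y + w)) * (std_normal_density y *\<^sub>R cnj (e y)))"
      by (simp only: integral_mult_left_zero)
    then show "I * (std_normal_density y *\<^sub>R cnj (e y)) = (LINT w|lborel. G (w, y))"
      by (simp add: G_def mult_ac)
  qed
  also have "\<dots> = (LINT w|lborel. LINT y|lborel. G (w, y))"
    using lborel_pair.Fubini_integral[of "\<lambda>w y. G (w, y)"] int by simp
  finally have II: "I * cnj I = (LINT w|lborel. LINT y|lborel. G (w, y))" .
  have inner: "cmod (LINT y|lborel. G (w, y))
      = 1 / sqrt (1 + 4 * a\<^sup>2) * normal_density 0 (sqrt (2 / (1 + 4 * a\<^sup>2))) w" for w
  proof -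
    have "G (w, y) = complex_of_real (normal_density 0 (sqrt 2) w)
        * (normal_density (- w / 2) (1 / sqrt 2) y *\<^sub>R iexp ((2 * a * w) * y + a * (w\<^sup>2 + 2 * m * w)))" for y
    proof -
      have "cnj (e y) = iexp (- (a * (y + m)\<^sup>2))" by (simp add: e_def exp_cnj)
      then have "e (y + w) * cnj (e y) = iexp (a * (y + w + m)\<^sup>2 + - (a * (y + m)\<^sup>2))"
        by (simp only: e_def exp_add[symmetric] of_real_add distrib_left)
      also have "a * (y + w + m)\<^sup>2 + - (a * (y + m)\<^sup>2) = (2 * a * w) * y + a * (w\<^sup>2 + 2 * m * w)"
        by (simp add: power2_eq_square algebra_simps)
      finally show ?thesis
        by (simp add: G_def std_normal_density_mult_shift scaleR_conv_of_real)
    qed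
    then have "(LINT y|lborel. G (w, y)) = complex_of_real (normal_density 0 (sqrt 2) w)
        * (LINT y|lborel. normal_density (- w / 2) (1 / sqrt 2) y *\<^sub>R iexp ((2 * a * w) * y + a * (w\<^sup>2 + 2 * m * w)))"
      by (simp only: integral_mult_right_zero)
    then have "cmod (LINT y|lborel. G (w, y)) = normal_density 0 (sqrt 2) w * exp (- (2 * a * w * (1 / sqrt 2))\<^sup>2 / 2)"
      by (simp only: norm_mult) (subst cmod_normal_density_iexp_linear, simp_all)
    also have "- (2 * a * w * (1 / sqrt 2))\<^sup>2 / 2 = - (a\<^sup>2 * w\<^sup>2)"
      by (simp add: power_mult_distrib power_divide)
    finally have "cmod (LINT y|lborel. G (w, y)) = normal_density 0 (sqrt 2) w * exp (- (a\<^sup>2 * w\<^sup>2))" .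
    then show ?thesis by (simp only: normal_density_mult_gauss)
  qed
  have pos: "1 + 4 * a\<^sup>2 > 0" by (rule add_pos_nonneg) auto
  have "(cmod I)\<^sup>2 = cmod (I * cnj I)" by (simp add: norm_mult power2_eq_square)
  also have "\<dots> \<le> (LINT w|lborel. cmod (LINT y|lborel. G (w, y)))"
    unfolding II by (rule integral_norm_bound)
  also have "\<dots> = 1 / sqrt (1 + 4 * a\<^sup>2)"
    using pos unfolding inner by simp
  also have "I = (CLINT x|std_normal_distribution. iexp (a * (x + m)\<^sup>2))"
    unfolding I_def e_def by (subst integral_density) auto
  finally show ?thesis .
qed

lemma std_normal_measure_ball_le:
  assumes "0 \<le> s"
  shows "measure std_normal_distribution {-s..s} \<le> s"
proof -
  have "emeasure std_normal_distribution {-s..s}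
      = (\<integral>\<^sup>+x. ennreal (std_normal_density x) * indicator {-s..s} x \<partial>lborel)"
    by (rule emeasure_density) auto
  also have "\<dots> \<le> (\<integral>\<^sup>+x. ennreal (1 / 2) * indicator {-s..s} x \<partial>lborel)"
  proof (intro nn_integral_mono mult_right_mono ennreal_leI)
    fix x :: real
    have "2 \<le> sqrt (2 * pi)" using pi_gt3 by (intro real_le_rsqrt) simp
    then have "1 / sqrt (2 * pi) \<le> 1 / 2" by (intro divide_left_mono) auto
    moreover have "exp (- x\<^sup>2 / 2) \<le> 1" by simp
    ultimately have "1 / sqrt (2 * pi) * exp (- x\<^sup>2 / 2) \<le> 1 / 2 * 1"
      by (intro mult_mono) auto
    then show "std_normal_density x \<le> 1 / 2" unfolding std_normal_density_def by simp
  qed auto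
  also have "\<dots> = ennreal (1 / 2) * ennreal (2 * s)"
    using assms by (subst nn_integral_cmult_indicator) auto
  also have "\<dots> = ennreal s" using assms by (subst ennreal_mult[symmetric]) auto
  finally show ?thesis
    using assms unfolding measure_def by (intro enn2real_leI) auto
qed

text \<open>
  The indicator of the interval is dominated by a multiple of the Gaussian bump
  \<open>exp (- ((z - x) / \<delta>)\<^sup>2 / 2)\<close>, which is itself a normal characteristic function.  By Fubini the mean of the
  bump is at most the mean of \<open>\<bar>char M (U / \<delta>)\<bar>\<close> with \<open>U\<close> standard normal.  The assumed decay is used for
  \<open>\<bar>U\<bar> > \<surd>\<delta>\<close>, and the complementary event has probability at most \<open>\<surd>\<delta>\<close>.
\<close>

lemma (in real_distribution) measure_interval_le_of_char_decay:
  assumes decay: "\<And>t. cmod (char M t) \<le> (1 + 4 * A * t\<^sup>2) powr (- 1 / 4)"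
    and "0 \<le> A" "0 < \<delta>"
  shows "measure M {x - \<delta>..x + \<delta>} \<le> exp (1 / 2) * (sqrt \<delta> + (1 + 4 * A / \<delta>) powr (- 1 / 4))"
proof -
  interpret N: prob_space std_normal_distribution by (rule prob_space_normal_density) simp
  interpret MN: pair_prob_space M std_normal_distribution ..
  define g where "g z = exp (- ((z - x) / \<delta>)\<^sup>2 / 2)" for z
  have [measurable]: "g \<in> borel_measurable borel" unfolding g_def by measurable
  have g_int: "integrable M g"
    by (rule integrable_const_bound[where B=1]) (auto simp: g_def)
  have ind_int: "integrable M (indicator {x - \<delta>..x + \<delta>} :: real \<Rightarrow> real)"
    by (rule integrable_const_bound[where B=1]) auto
  have "measure M {x - \<delta>..x + \<delta>} = (LINT z|M. indicator {x - \<delta>..x + \<delta>} z)" by simp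
  also have "\<dots> \<le> (LINT z|M. exp (1 / 2) * g z)"
  proof (intro integral_mono integrable_mult_right g_int ind_int)
    fix z
    show "indicator {x - \<delta>..x + \<delta>} z \<le> exp (1 / 2) * g z"
    proof (cases "z \<in> {x - \<delta>..x + \<delta>}")
      case True
      then have "\<bar>(z - x) / \<delta>\<bar> \<le> 1" using \<open>0 < \<delta>\<close> by (auto simp: abs_le_iff field_simps)
      then have "((z - x) / \<delta>)\<^sup>2 \<le> 1" by (simp only: abs_square_le_1)
      then have "1 \<le> exp (1 / 2 + - ((z - x) / \<delta>)\<^sup>2 / 2)" by simp
      then show ?thesis using True by (simp add: g_def exp_add[symmetric])
    qed (simp add: g_def)
  qed
  also have "\<dots> = exp (1 / 2) * (LINT z|M. g z)" by simp
  finally have 1: "measure M {x - \<delta>..x + \<delta>} \<le> exp (1 / 2) * (LINT z|M. g z)" .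
  have "complex_of_real (LINT z|M. g z) = (CLINT z|M. char std_normal_distribution ((z - x) / \<delta>))"
    by (simp add: char_std_normal_distribution g_def)
  also have "\<dots> = (CLINT z|M. CLINT u|std_normal_distribution. iexp ((z - x) / \<delta> * u))"
    by (simp add: char_def)
  also have "\<dots> = (CLINT u|std_normal_distribution. CLINT z|M. iexp ((z - x) / \<delta> * u))"
    by (rule MN.Fubini_integral[symmetric])
      (rule MN.integrable_const_bound[where B=1], auto simp del: of_real_mult of_real_divide of_real_diff)
  also have "\<dots> = (CLINT u|std_normal_distribution. iexp (- x / \<delta> * u) * char M (u / \<delta>))"
  proof (rule Bochner_Integration.integral_cong[OF refl])
    fix u :: real
    have "iexp ((z - x) / \<delta> * u) = iexp (- x / \<delta> * u) * iexp (u / \<delta> * z)" for z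
      using \<open>0 < \<delta>\<close> by (simp add: exp_add[symmetric] field_simps)
    then show "(CLINT z|M. iexp ((z - x) / \<delta> * u)) = iexp (- x / \<delta> * u) * char M (u / \<delta>)"
      unfolding char_def by (simp only: integral_mult_right_zero)
  qed
  finally have 2: "cmod (complex_of_real (LINT z|M. g z))
      \<le> (LINT u|std_normal_distribution. cmod (iexp (- x / \<delta> * u) * char M (u / \<delta>)))"
    by (simp only: integral_norm_bound)
  have ball_int: "integrable std_normal_distribution (indicator {- sqrt \<delta>..sqrt \<delta>} :: real \<Rightarrow> real)"
    by (rule N.integrable_const_bound[where B=1]) auto
  note 2
  also have "(LINT u|std_normal_distribution. cmod (iexp (- x / \<delta> * u) * char M (u / \<delta>)))
      = (LINT u|std_normal_distribution. cmod (char M (u / \<delta>)))"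
    by (simp add: norm_mult del: of_real_mult of_real_divide of_real_minus)
  also have "\<dots> \<le> (LINT u|std_normal_distribution.
      indicator {- sqrt \<delta>..sqrt \<delta>} u + (1 + 4 * A / \<delta>) powr (- 1 / 4))"
  proof (rule integral_mono)
    show "integrable std_normal_distribution (\<lambda>u. cmod (char M (u / \<delta>)))"
      by (rule N.integrable_const_bound[where B=1]) (auto simp: cmod_char_le_1)
    fix u :: real
    show "cmod (char M (u / \<delta>)) \<le> indicator {- sqrt \<delta>..sqrt \<delta>} u + (1 + 4 * A / \<delta>) powr (- 1 / 4)"
    proof (cases "u \<in> {- sqrt \<delta>..sqrt \<delta>}")
      case True then show ?thesis using cmod_char_le_1[of "u / \<delta>"] by (simp add: add_increasing2)
    next
      case False
      then have "sqrt \<delta> < \<bar>u\<bar>" by auto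
      then have "\<delta> \<le> u\<^sup>2" using \<open>0 < \<delta>\<close>
        by (metis abs_ge_zero less_imp_le power2_abs real_sqrt_le_iff real_sqrt_abs)
      then have "1 / \<delta> \<le> (u / \<delta>)\<^sup>2" using \<open>0 < \<delta>\<close> by (simp add: power2_eq_square field_simps)
      then have "4 * A * (1 / \<delta>) \<le> 4 * A * (u / \<delta>)\<^sup>2" using \<open>0 \<le> A\<close> by (intro mult_left_mono) auto
      moreover have "0 \<le> 4 * A / \<delta>" using assms by simp
      ultimately have "(1 + 4 * A * (u / \<delta>)\<^sup>2) powr (- 1 / 4) \<le> (1 + 4 * A / \<delta>) powr (- 1 / 4)"
        by (intro powr_mono2') auto
      then show ?thesis using decay[of "u / \<delta>"] False by simp
    qed
  qed (intro Bochner_Integration.integrable_add ball_int N.integrable_const)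
  also have "\<dots> = measure std_normal_distribution {- sqrt \<delta>..sqrt \<delta>} + (1 + 4 * A / \<delta>) powr (- 1 / 4)"
    using N.prob_space by (subst Bochner_Integration.integral_add[OF ball_int]) auto
  also have "\<dots> \<le> sqrt \<delta> + (1 + 4 * A / \<delta>) powr (- 1 / 4)"
    using std_normal_measure_ball_le[of "sqrt \<delta>"] \<open>0 < \<delta>\<close> by simp
  finally have "(LINT z|M. g z) \<le> sqrt \<delta> + (1 + 4 * A / \<delta>) powr (- 1 / 4)" by simp
  then show ?thesis using 1 by (meson exp_ge_zero mult_left_mono order_trans)
qed

section \<open>Means and distribution functions\<close>

definition clip :: "real \<Rightarrow> real \<Rightarrow> real" where
  "clip K x = max (- K) (min K x)"

lemma clip_measurable [measurable]: "clip K \<in> borel_measurable borel"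
  unfolding clip_def by measurable

text \<open>
  Truncation costs little in the mean: together with a second moment bound, this lets bounded windows
  of thresholds determine means up to an error of order \<open>1 / K\<close>.
\<close>

lemma abs_diff_clip_le:
  assumes "0 < K"
  shows "\<bar>x - clip K x\<bar> \<le> x\<^sup>2 / K"
proof (cases "\<bar>x\<bar> \<le> K")
  case True
  then have "clip K x = x" by (auto simp: clip_def)
  then show ?thesis using assms by simp
next
  case False
  then have "\<bar>x - clip K x\<bar> \<le> \<bar>x\<bar>" using assms by (auto simp: clip_def)
  also have "\<dots> \<le> \<bar>x\<bar> * (\<bar>x\<bar> / K)"
    using False assms mult_left_mono[of 1 "\<bar>x\<bar> / K" "\<bar>x\<bar>"] by simp
  also have "\<dots> = x\<^sup>2 / K" by (simp add: power2_eq_square)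
  finally show ?thesis .
qed

context prob_space begin

lemma expectation_clip_layer_cake:
  assumes [measurable]: "random_variable borel X" and "0 < K"
  shows "ennreal (expectation (\<lambda>\<omega>. clip K (X \<omega>)) + K)
    = (\<integral>\<^sup>+c. indicator {-K..K} c * ennreal (prob {\<omega> \<in> space M. c < X \<omega>}) \<partial>lborel)"
proof -
  interpret P: pair_sigma_finite M lborel ..
  have int: "integrable M (\<lambda>\<omega>. clip K (X \<omega>))"
    by (rule integrable_const_bound[where B=K]) (use \<open>0 < K\<close> in \<open>auto simp: clip_def\<close>)
  have "ennreal (expectation (\<lambda>\<omega>. clip K (X \<omega>)) + K) = ennreal (expectation (\<lambda>\<omega>. clip K (X \<omega>) + K))"
    using int by (simp add: prob_space)
  also have "\<dots> = (\<integral>\<^sup>+\<omega>. ennreal (clip K (X \<omega>) + K) \<partial>M)"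
    using int by (intro nn_integral_eq_integral[symmetric]) (auto simp: clip_def)
  also have "\<dots> = (\<integral>\<^sup>+\<omega>. \<integral>\<^sup>+c. indicator {-K..K} c * indicator {c. c < X \<omega>} c \<partial>lborel \<partial>M)"
  proof (rule nn_integral_cong)
    fix \<omega>
    have "(\<integral>\<^sup>+c. indicator {-K..K} c * indicator {c. c < X \<omega>} c \<partial>lborel)
        = (\<integral>\<^sup>+c. indicator ({-K..K} \<inter> {..<X \<omega>}) c \<partial>lborel)"
      by (intro nn_integral_cong) (auto simp: indicator_def)
    also have "\<dots> = emeasure lborel ({-K..K} \<inter> {..<X \<omega>})" by simp
    also have "\<dots> = ennreal (clip K (X \<omega>) + K)"
    proof -
      consider "X \<omega> \<le> - K" | "- K < X \<omega>" "X \<omega> \<le> K" | "K < X \<omega>" by linarith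
      then show ?thesis
      proof cases
        case 1
        then have "{-K..K} \<inter> {..<X \<omega>} = {}" by auto
        then show ?thesis using 1 \<open>0 < K\<close> by (simp add: clip_def)
      next
        case 2
        then have "{-K..K} \<inter> {..<X \<omega>} = {-K..<X \<omega>}" by auto
        then show ?thesis using 2 \<open>0 < K\<close> by (simp add: clip_def)
      next
        case 3
        then have "{-K..K} \<inter> {..<X \<omega>} = {-K..K}" by auto
        then show ?thesis using 3 \<open>0 < K\<close> by (simp add: clip_def)
      qed
    qed
    finally show "ennreal (clip K (X \<omega>) + K)
        = (\<integral>\<^sup>+c. indicator {-K..K} c * indicator {c. c < X \<omega>} c \<partial>lborel)" by simp
  qed
  also have "\<dots> = (\<integral>\<^sup>+c. \<integral>\<^sup>+\<omega>. indicator {-K..K} c * indicator {c. c < X \<omega>} c \<partial>M \<partial>lborel)"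
    by (rule P.Fubini'[symmetric]) measurable
  also have "\<dots> = (\<integral>\<^sup>+c. indicator {-K..K} c * ennreal (prob {\<omega> \<in> space M. c < X \<omega>}) \<partial>lborel)"
  proof (rule nn_integral_cong)
    fix c :: real
    have "(\<integral>\<^sup>+\<omega>. indicator {-K..K} c * indicator {c. c < X \<omega>} c \<partial>M)
        = indicator {-K..K} c * (\<integral>\<^sup>+\<omega>. indicator {c. c < X \<omega>} c \<partial>M)"
      by (rule nn_integral_cmult) measurable
    also have "(\<integral>\<^sup>+\<omega>. indicator {c. c < X \<omega>} c \<partial>M) = (\<integral>\<^sup>+\<omega>. indicator {\<omega> \<in> space M. c < X \<omega>} \<omega> \<partial>M)"
      by (intro nn_integral_cong) (auto simp: indicator_def)
    also have "\<dots> = ennreal (prob {\<omega> \<in> space M. c < X \<omega>})" by (simp add: emeasure_eq_measure)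
    finally show "(\<integral>\<^sup>+\<omega>. indicator {-K..K} c * indicator {c. c < X \<omega>} c \<partial>M)
        = indicator {-K..K} c * ennreal (prob {\<omega> \<in> space M. c < X \<omega>})" .
  qed
  finally show ?thesis .
qed

text \<open>
  If \<open>Y\<close> is hardly larger than \<open>X\<close> in the sense of distribution functions, then its mean is hardly
  larger.  Integrating the tails over \<open>[-K, K]\<close> gives \<open>2 K \<eta>\<close> for the clipped variables, and clipping
  changes the means by at most \<open>m / K\<close> in total; the bound comes from balancing the two.
\<close>

lemma expectation_diff_le_of_cdf_diff_le:
  assumes [measurable]: "random_variable borel X" "random_variable borel Y"
    and X2: "integrable M (\<lambda>\<omega>. (X \<omega>)\<^sup>2)" and Y2: "integrable M (\<lambda>\<omega>. (Y \<omega>)\<^sup>2)"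
    and cdf: "\<And>c. prob {\<omega> \<in> space M. X \<omega> \<le> c} - prob {\<omega> \<in> space M. Y \<omega> \<le> c} \<le> \<eta>"
    and m: "expectation (\<lambda>\<omega>. (X \<omega>)\<^sup>2) + expectation (\<lambda>\<omega>. (Y \<omega>)\<^sup>2) \<le> m"
    and pos: "0 < m" "0 < \<eta>"
  shows "expectation Y - expectation X \<le> 2 * sqrt (2 * \<eta> * m)"
proof -
  \<comment> \<open>This choice equalizes \<open>2 K \<eta>\<close> and \<open>m / K\<close>.\<close>
  define K where "K = sqrt (m / (2 * \<eta>))"
  have K: "0 < K" using pos by (simp add: K_def)
  have int: "integrable M X" "integrable M Y"
    using X2 Y2 by (auto intro: square_integrable_imp_integrable)
  have intc: "integrable M (\<lambda>\<omega>. clip K (Z \<omega>))" if [measurable]: "random_variable borel Z" for Z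
    by (rule integrable_const_bound[where B=K]) (use \<open>0 < K\<close> in \<open>auto simp: clip_def\<close>)
  have cge: "- K \<le> expectation (\<lambda>\<omega>. clip K (Z \<omega>))" if [measurable]: "random_variable borel Z" for Z
    using integral_mono[OF integrable_const intc[OF that], of "- K"] by (simp add: clip_def prob_space)
  have "ennreal (expectation (\<lambda>\<omega>. clip K (Y \<omega>)) + K)
      = (\<integral>\<^sup>+c. indicator {-K..K} c * ennreal (prob {\<omega> \<in> space M. c < Y \<omega>}) \<partial>lborel)"
    using K by (rule expectation_clip_layer_cake[OF assms(2)])
  also have "\<dots> \<le> (\<integral>\<^sup>+c. indicator {-K..K} c * ennreal (prob {\<omega> \<in> space M. c < X \<omega>})
      + ennreal \<eta> * indicator {-K..K} c \<partial>lborel)"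
  proof (rule nn_integral_mono)
    fix c :: real
    have compl: "prob {\<omega> \<in> space M. c < Z \<omega>} = 1 - prob {\<omega> \<in> space M. Z \<omega> \<le> c}"
      if [measurable]: "random_variable borel Z" for Z
      by (subst prob_compl[symmetric]) (auto intro!: arg_cong[where f=prob])
    have "prob {\<omega> \<in> space M. c < Y \<omega>} \<le> prob {\<omega> \<in> space M. c < X \<omega>} + \<eta>"
      using cdf[of c] by (simp add: compl)
    then have "ennreal (prob {\<omega> \<in> space M. c < Y \<omega>}) \<le> ennreal (prob {\<omega> \<in> space M. c < X \<omega>}) + ennreal \<eta>"
      using pos by (simp add: ennreal_plus[symmetric] del: ennreal_plus)
    then show "indicator {-K..K} c * ennreal (prob {\<omega> \<in> space M. c < Y \<omega>})
        \<le> indicator {-K..K} c * ennreal (prob {\<omega> \<in> space M. c < X \<omega>}) + ennreal \<eta> * indicator {-K..K} c"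
      by (auto simp: indicator_def)
  qed
  also have "\<dots> = ennreal (expectation (\<lambda>\<omega>. clip K (X \<omega>)) + K) + ennreal \<eta> * ennreal (2 * K)"
  proof (subst nn_integral_add)
    show "(\<lambda>c. indicator {-K..K} c * ennreal (prob {\<omega> \<in> space M. c < X \<omega>})) \<in> borel_measurable lborel"
      by measurable
    show "(\<integral>\<^sup>+c. indicator {-K..K} c * ennreal (prob {\<omega> \<in> space M. c < X \<omega>}) \<partial>lborel)
        + (\<integral>\<^sup>+c. ennreal \<eta> * indicator {-K..K} c \<partial>lborel)
        = ennreal (expectation (\<lambda>\<omega>. clip K (X \<omega>)) + K) + ennreal \<eta> * ennreal (2 * K)"
      using K by (subst expectation_clip_layer_cake[OF assms(1)], simp, subst nn_integral_cmult_indicator) auto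
  qed measurable
  also have "\<dots> = ennreal (expectation (\<lambda>\<omega>. clip K (X \<omega>)) + K + \<eta> * (2 * K))"
    using cge[OF assms(1)] K pos by (simp add: ennreal_mult)
  finally have clip_le: "expectation (\<lambda>\<omega>. clip K (Y \<omega>)) \<le> expectation (\<lambda>\<omega>. clip K (X \<omega>)) + 2 * K * \<eta>"
  proof (subst (asm) ennreal_le_iff)
    show "0 \<le> expectation (\<lambda>\<omega>. clip K (X \<omega>)) + K + \<eta> * (2 * K)"
      using cge[OF assms(1)] mult_pos_pos[OF K pos(2)] by (simp add: mult_ac)
  qed (simp add: algebra_simps)
  have near: "\<bar>expectation Z - expectation (\<lambda>\<omega>. clip K (Z \<omega>))\<bar> \<le> expectation (\<lambda>\<omega>. (Z \<omega>)\<^sup>2) / K"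
    if [measurable]: "random_variable borel Z" and "integrable M Z" "integrable M (\<lambda>\<omega>. (Z \<omega>)\<^sup>2)" for Z
  proof -
    have "\<bar>expectation Z - expectation (\<lambda>\<omega>. clip K (Z \<omega>))\<bar> = \<bar>expectation (\<lambda>\<omega>. Z \<omega> - clip K (Z \<omega>))\<bar>"
      using that intc by simp
    also have "\<dots> \<le> expectation (\<lambda>\<omega>. (Z \<omega>)\<^sup>2 / K)"
      using that intc K by (intro order_trans[OF integral_abs_bound] integral_mono) (auto simp: abs_diff_clip_le)
    finally show ?thesis by simp
  qed
  have "expectation Y - expectation X
      \<le> 2 * K * \<eta> + (expectation (\<lambda>\<omega>. (X \<omega>)\<^sup>2) + expectation (\<lambda>\<omega>. (Y \<omega>)\<^sup>2)) / K"
    using near[of X] near[of Y] int X2 Y2 clip_le by (simp add: add_divide_distrib abs_le_iff)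
  also have "\<dots> \<le> 2 * K * \<eta> + m / K" using m K by (intro add_left_mono divide_right_mono) auto
  also have "\<dots> = 2 * sqrt (2 * \<eta> * m)"
  proof -
    have "K * K = m / (2 * \<eta>)" using pos by (simp add: K_def)
    then have "m / K = 2 * K * \<eta>" using K pos by (simp add: field_simps)
    moreover have "2 * K * \<eta> = sqrt (2 * \<eta> * m)"
    proof (rule sym, rule real_sqrt_unique)
      show "(2 * K * \<eta>)\<^sup>2 = 2 * \<eta> * m"
        using \<open>K * K = m / (2 * \<eta>)\<close> pos by (simp add: power2_eq_square field_simps)
    qed (use K pos in auto)
    ultimately show ?thesis by simp
  qed
  finally show ?thesis .
qed

end

section \<open>Independent standard normal sequences\<close>

text \<open>
  Fatou's lemma.  It carries second moment bounds from partial sums to random series that are only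
  known to converge almost surely.
\<close>

lemma second_moment_of_limit:
  fixes S :: "nat \<Rightarrow> 'a \<Rightarrow> real"
  assumes [measurable]: "\<And>N. S N \<in> borel_measurable M" "Z \<in> borel_measurable M"
    and int: "\<And>N. integrable M (\<lambda>\<omega>. (S N \<omega>)\<^sup>2)"
    and bound: "\<And>N. (LINT \<omega>|M. (S N \<omega>)\<^sup>2) \<le> V"
    and lim: "AE \<omega> in M. (\<lambda>N. S N \<omega>) \<longlonglongrightarrow> Z \<omega>"
  shows "integrable M (\<lambda>\<omega>. (Z \<omega>)\<^sup>2)" "(LINT \<omega>|M. (Z \<omega>)\<^sup>2) \<le> V"
proof -
  have V: "0 \<le> V" using bound[of 0] by (rule order_trans[rotated]) simp
  have "(\<integral>\<^sup>+\<omega>. ennreal ((Z \<omega>)\<^sup>2) \<partial>M) = (\<integral>\<^sup>+\<omega>. liminf (\<lambda>N. ennreal ((S N \<omega>)\<^sup>2)) \<partial>M)"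
  proof (rule nn_integral_cong_AE)
    show "AE \<omega> in M. ennreal ((Z \<omega>)\<^sup>2) = liminf (\<lambda>N. ennreal ((S N \<omega>)\<^sup>2))"
      using lim
    proof eventually_elim
      case (elim \<omega>)
      then have "(\<lambda>N. ennreal ((S N \<omega>)\<^sup>2)) \<longlonglongrightarrow> ennreal ((Z \<omega>)\<^sup>2)"
        by (intro tendsto_intros tendsto_ennrealI)
      then show ?case by (metis lim_imp_Liminf trivial_limit_sequentially)
    qed
  qed
  also have "\<dots> \<le> liminf (\<lambda>N. \<integral>\<^sup>+\<omega>. ennreal ((S N \<omega>)\<^sup>2) \<partial>M)"
    by (rule nn_integral_liminf) measurable
  also have "\<dots> \<le> liminf (\<lambda>N. ennreal V)"
  proof (intro Liminf_mono always_eventually allI)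
    fix N
    have "(\<integral>\<^sup>+\<omega>. ennreal ((S N \<omega>)\<^sup>2) \<partial>M) = ennreal (LINT \<omega>|M. (S N \<omega>)\<^sup>2)"
      using int by (intro nn_integral_eq_integral) auto
    then show "(\<integral>\<^sup>+\<omega>. ennreal ((S N \<omega>)\<^sup>2) \<partial>M) \<le> ennreal V"
      using bound by (simp add: ennreal_leI)
  qed
  also have "\<dots> = ennreal V" by (simp add: Liminf_const)
  finally have le: "(\<integral>\<^sup>+\<omega>. ennreal ((Z \<omega>)\<^sup>2) \<partial>M) \<le> ennreal V" .
  show int_Z: "integrable M (\<lambda>\<omega>. (Z \<omega>)\<^sup>2)"
    by (rule integrableI_bounded) (use le in \<open>auto intro: le_less_trans\<close>)
  show "(LINT \<omega>|M. (Z \<omega>)\<^sup>2) \<le> V"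
    using le V by (subst (asm) nn_integral_eq_integral[OF int_Z]) auto
qed

locale std_normal_sequence = prob_space M for M :: "'a measure" +
  fixes \<xi> :: "nat \<Rightarrow> 'a \<Rightarrow> real"
  assumes indep: "indep_vars (\<lambda>_. borel) \<xi> UNIV"
    and std_normal: "\<And>j. distributed M lborel (\<xi> j) std_normal_density"
begin

lemma measurable_xi [measurable]: "random_variable borel (\<xi> j)"
  using distributed_measurable[OF std_normal[of j]] by simp

lemma distr_xi: "distr M borel (\<xi> j) = std_normal_distribution"
  using distributed_distr_eq_density[OF std_normal[of j]] by (simp cong: distr_cong)

lemma
  shows integrable_xi_power: "integrable M (\<lambda>\<omega>. \<xi> j \<omega> ^ k)"
    and expectation_xi_power: "expectation (\<lambda>\<omega>. \<xi> j \<omega> ^ k) = (LINT x|lborel. std_normal_density x * x ^ k)"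
proof -
  show "integrable M (\<lambda>\<omega>. \<xi> j \<omega> ^ k)"
    using integrable_std_normal_moment[of k] distributed_integrable[OF std_normal[of j], of "\<lambda>x. x ^ k"] by simp
  show "expectation (\<lambda>\<omega>. \<xi> j \<omega> ^ k) = (LINT x|lborel. std_normal_density x * x ^ k)"
    using distributed_integral[OF std_normal[of j], of "\<lambda>x. x ^ k"] by simp
qed

lemma integrable_xi [simp]: "integrable M (\<xi> j)" "integrable M (\<lambda>\<omega>. (\<xi> j \<omega>)\<^sup>2)"
    "integrable M (\<lambda>\<omega>. \<xi> j \<omega> ^ 3)" "integrable M (\<lambda>\<omega>. \<xi> j \<omega> ^ 4)"
  using integrable_xi_power[of j 1] integrable_xi_power[of j 2] integrable_xi_power[of j 3]
    integrable_xi_power[of j 4] by simp_all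

lemma expectation_xi [simp]: "expectation (\<xi> j) = 0" "expectation (\<lambda>\<omega>. (\<xi> j \<omega>)\<^sup>2) = 1"
    "expectation (\<lambda>\<omega>. \<xi> j \<omega> ^ 3) = 0" "expectation (\<lambda>\<omega>. \<xi> j \<omega> ^ 4) = 3"
  using expectation_xi_power[of j 1] expectation_xi_power[of j 2] expectation_xi_power[of j 3]
    expectation_xi_power[of j 4]
    integral_std_normal_moment_odd[of 0] integral_std_normal_moment_odd[of 1]
    integral_std_normal_moment_even[of 1] integral_std_normal_moment_even[of 2]
  by (simp_all add: fact_numeral eval_nat_numeral)

text \<open>
  Independence removes the products of different summands.  Within a summand \<open>\<xi>\<^sup>2 - 1\<close> and \<open>\<xi>\<close> are
  orthogonal, being Hermite polynomials, with squared norms 2 and 1; they span the Wiener chaoses of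
  order 2 and 1.
\<close>

lemma
  defines "X a b \<equiv> \<lambda>j \<omega>. a j * ((\<xi> j \<omega>)\<^sup>2 - 1) + b j * \<xi> j \<omega> :: real"
  shows integrable_chaos_sq: "integrable M (\<lambda>\<omega>. (\<Sum>j<N. X a b j \<omega>)\<^sup>2)"
    and expectation_chaos_sq: "expectation (\<lambda>\<omega>. (\<Sum>j<N. X a b j \<omega>)\<^sup>2) = (\<Sum>j<N. 2 * (a j)\<^sup>2 + (b j)\<^sup>2)"
proof -
  let ?X = "X a b"
  have int: "integrable M (?X j)" and mean: "expectation (?X j) = 0" for j
    by (simp_all add: X_def prob_space)
  have sq: "(\<lambda>\<omega>. ?X j \<omega> * ?X j \<omega>) = (\<lambda>\<omega>. (a j)\<^sup>2 * \<xi> j \<omega> ^ 4 + (2 * a j * b j) * \<xi> j \<omega> ^ 3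
      + ((b j)\<^sup>2 - 2 * (a j)\<^sup>2) * (\<xi> j \<omega>)\<^sup>2 - 2 * a j * b j * \<xi> j \<omega> + (a j)\<^sup>2)" for j
    unfolding X_def by (intro ext) (simp add: power2_eq_square power3_eq_cube power4_eq_xxxx algebra_simps)
  have diag: "integrable M (\<lambda>\<omega>. ?X j \<omega> * ?X j \<omega>)"
      "expectation (\<lambda>\<omega>. ?X j \<omega> * ?X j \<omega>) = 2 * (a j)\<^sup>2 + (b j)\<^sup>2" for j
    unfolding sq by (simp_all add: prob_space)
  have indep_X: "indep_vars (\<lambda>_. borel) ?X UNIV"
    unfolding X_def using indep_vars_compose2[OF indep, of "\<lambda>j x. a j * (x\<^sup>2 - 1) + b j * x" "\<lambda>_. borel"] by simp
  have off: "integrable M (\<lambda>\<omega>. ?X i \<omega> * ?X j \<omega>) \<and> expectation (\<lambda>\<omega>. ?X i \<omega> * ?X j \<omega>) = 0" if "i \<noteq> j" for i j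
    using that indep_vars_integrable[of "{i, j}" ?X] indep_vars_lebesgue_integral[of "{i, j}" ?X]
      indep_vars_subset[OF indep_X, of "{i, j}"] int mean by simp
  have int2: "integrable M (\<lambda>\<omega>. ?X i \<omega> * ?X j \<omega>)" for i j
    using diag off by (cases "i = j") auto
  have E2: "expectation (\<lambda>\<omega>. ?X i \<omega> * ?X j \<omega>) = (if i = j then 2 * (a i)\<^sup>2 + (b i)\<^sup>2 else 0)" for i j
    using diag off by (cases "i = j") auto
  show "integrable M (\<lambda>\<omega>. (\<Sum>j<N. ?X j \<omega>)\<^sup>2)"
    unfolding power2_eq_square sum_product by (intro Bochner_Integration.integrable_sum int2)
  show "expectation (\<lambda>\<omega>. (\<Sum>j<N. ?X j \<omega>)\<^sup>2) = (\<Sum>j<N. 2 * (a j)\<^sup>2 + (b j)\<^sup>2)"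
    unfolding power2_eq_square sum_product using int2
    by (simp add: Bochner_Integration.integral_sum E2[unfolded power2_eq_square])
qed

lemma
  assumes "summable (\<lambda>j. (a j)\<^sup>2)" "summable (\<lambda>j. (b j)\<^sup>2)"
    and [measurable]: "random_variable borel Z"
    and "AE \<omega> in M. (\<lambda>j. a j * ((\<xi> j \<omega>)\<^sup>2 - 1) + b j * \<xi> j \<omega>) sums Z \<omega>"
  shows integrable_chaos_limit_sq: "integrable M (\<lambda>\<omega>. (Z \<omega>)\<^sup>2)"
    and expectation_chaos_limit_sq_le: "expectation (\<lambda>\<omega>. (Z \<omega>)\<^sup>2) \<le> 2 * (\<Sum>j. (a j)\<^sup>2) + (\<Sum>j. (b j)\<^sup>2)"
proof -
  have "(\<lambda>j. 2 * (a j)\<^sup>2 + (b j)\<^sup>2) sums (2 * (\<Sum>j. (a j)\<^sup>2) + (\<Sum>j. (b j)\<^sup>2))"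
    using assms by (intro sums_add sums_mult summable_sums)
  then have "(\<Sum>j<N. 2 * (a j)\<^sup>2 + (b j)\<^sup>2) \<le> 2 * (\<Sum>j. (a j)\<^sup>2) + (\<Sum>j. (b j)\<^sup>2)" for N
    by (intro sum_le_suminf[of _ "{..<N}", THEN order_trans]) (auto simp: sums_iff)
  then have bound: "expectation (\<lambda>\<omega>. (\<Sum>j<N. a j * ((\<xi> j \<omega>)\<^sup>2 - 1) + b j * \<xi> j \<omega>)\<^sup>2)
      \<le> 2 * (\<Sum>j. (a j)\<^sup>2) + (\<Sum>j. (b j)\<^sup>2)" for N
    by (simp add: expectation_chaos_sq)
  note lim = second_moment_of_limit[of "\<lambda>N \<omega>. \<Sum>j<N. a j * ((\<xi> j \<omega>)\<^sup>2 - 1) + b j * \<xi> j \<omega>" M Z,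
      OF _ _ integrable_chaos_sq bound assms(4)[unfolded sums_def]]
  show "integrable M (\<lambda>\<omega>. (Z \<omega>)\<^sup>2)" by (rule lim) measurable
  show "expectation (\<lambda>\<omega>. (Z \<omega>)\<^sup>2) \<le> 2 * (\<Sum>j. (a j)\<^sup>2) + (\<Sum>j. (b j)\<^sup>2)" by (rule lim) measurable
qed

end

section \<open>Weighted sums of noncentral chi-square variables\<close>

text \<open>
  Turns the product of the one-dimensional bounds into a bound in terms of \<open>\<Sum> a\<^sub>j\<^sup>2\<close> alone.
\<close>

lemma one_plus_sum_le_prod:
  fixes x :: "'b \<Rightarrow> real"
  assumes "\<And>i. i \<in> I \<Longrightarrow> 0 \<le> x i"
  shows "1 + (\<Sum>i\<in>I. x i) \<le> (\<Prod>i\<in>I. 1 + x i)"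
  using assms
proof (induction I rule: infinite_finite_induct)
  case (insert i I)
  have "1 + (x i + sum x I) \<le> (1 + x i) * (1 + sum x I)"
    using insert.prems by (simp add: distrib_left distrib_right sum_nonneg)
  also have "\<dots> \<le> (1 + x i) * (\<Prod>i\<in>I. 1 + x i)"
    using insert by (intro mult_left_mono) auto
  finally show ?case using insert.hyps by simp
qed auto

context std_normal_sequence begin

definition chi_sq :: "(nat \<Rightarrow> real) \<Rightarrow> (nat \<Rightarrow> real) \<Rightarrow> 'a \<Rightarrow> real" where
  "chi_sq a \<mu> \<omega> = (\<Sum>j. a j * (\<xi> j \<omega> + \<mu> j)\<^sup>2)"

lemma measurable_chi_sq [measurable]: "random_variable borel (chi_sq a \<mu>)"
  unfolding chi_sq_def by measurable

context
  fixes a :: "nat \<Rightarrow> real"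
  assumes a_nonneg: "\<And>j. 0 \<le> a j" and a_summable: "summable a"
begin

lemma summable_weights_sq: "summable (\<lambda>j. (a j)\<^sup>2)"
proof (rule summable_comparison_test')
  show "summable (\<lambda>j. suminf a * a j)" using a_summable by (rule summable_mult)
  fix j
  have "a j \<le> suminf a" using sum_le_suminf[OF a_summable, of "{j}"] a_nonneg by simp
  then show "norm ((a j)\<^sup>2) \<le> suminf a * a j"
    using a_nonneg[of j] by (simp add: power2_eq_square mult_right_mono)
qed

lemma weight_le_sqrt: "a j \<le> sqrt (\<Sum>j. (a j)\<^sup>2)"
  using sum_le_suminf[OF summable_weights_sq, of "{j}"] by (intro real_le_rsqrt) simp

lemma
  assumes "summable (\<lambda>j. a j * (\<mu> j)\<^sup>2)"
  shows summable_weights_sq_shift: "summable (\<lambda>j. (a j * \<mu> j)\<^sup>2)"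
    and suminf_weights_sq_shift_le: "(\<Sum>j. (a j * \<mu> j)\<^sup>2) \<le> sqrt (\<Sum>j. (a j)\<^sup>2) * (\<Sum>j. a j * (\<mu> j)\<^sup>2)"
proof -
  let ?s = "sqrt (\<Sum>j. (a j)\<^sup>2)"
  have le: "(a j * \<mu> j)\<^sup>2 \<le> ?s * (a j * (\<mu> j)\<^sup>2)" for j
  proof -
    have "0 \<le> a j * (\<mu> j)\<^sup>2" using a_nonneg[of j] by simp
    moreover have "(a j * \<mu> j)\<^sup>2 = a j * (a j * (\<mu> j)\<^sup>2)" by (simp add: power2_eq_square mult_ac)
    ultimately show ?thesis using mult_right_mono[OF weight_le_sqrt[of j]] by simp
  qed
  have s: "summable (\<lambda>j. ?s * (a j * (\<mu> j)\<^sup>2))" using assms by (rule summable_mult)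
  show sm: "summable (\<lambda>j. (a j * \<mu> j)\<^sup>2)"
    by (rule summable_comparison_test'[OF s]) (simp add: le)
  show "(\<Sum>j. (a j * \<mu> j)\<^sup>2) \<le> ?s * (\<Sum>j. a j * (\<mu> j)\<^sup>2)"
    using suminf_le[OF le sm s] assms by (simp add: suminf_mult)
qed

lemma summable_weighted_product:
  assumes "summable (\<lambda>j. a j * (\<mu> j)\<^sup>2)" "summable (\<lambda>j. a j * (\<nu> j)\<^sup>2)"
  shows "summable (\<lambda>j. a j * (\<mu> j * \<nu> j))"
proof (rule summable_comparison_test')
  show "summable (\<lambda>j. a j * (\<mu> j)\<^sup>2 + a j * (\<nu> j)\<^sup>2)" using assms by (rule summable_add)
  fix j
  have "\<bar>\<mu> j * \<nu> j\<bar> \<le> (\<mu> j)\<^sup>2 + (\<nu> j)\<^sup>2"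
  proof -
    have "0 \<le> \<bar>\<mu> j\<bar> * \<bar>\<nu> j\<bar>" by simp
    with sum_squares_bound[of "\<bar>\<mu> j\<bar>" "\<bar>\<nu> j\<bar>"] show ?thesis
      unfolding abs_mult power2_abs by linarith
  qed
  then show "norm (a j * (\<mu> j * \<nu> j)) \<le> a j * (\<mu> j)\<^sup>2 + a j * (\<nu> j)\<^sup>2"
    using a_nonneg[of j] mult_left_mono[of "\<bar>\<mu> j * \<nu> j\<bar>" "(\<mu> j)\<^sup>2 + (\<nu> j)\<^sup>2" "a j"]
    by (simp add: abs_mult distrib_left)
qed

lemma summable_shift_add:
  assumes "summable (\<lambda>j. a j * (\<mu> j)\<^sup>2)" "summable (\<lambda>j. a j * (\<nu> j)\<^sup>2)"
  shows "summable (\<lambda>j. a j * (\<mu> j + \<nu> j)\<^sup>2)"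
proof -
  have "(\<lambda>j. a j * (\<mu> j + \<nu> j)\<^sup>2) = (\<lambda>j. a j * (\<mu> j)\<^sup>2 + 2 * (a j * (\<mu> j * \<nu> j)) + a j * (\<nu> j)\<^sup>2)"
    by (simp add: power2_eq_square algebra_simps)
  then show ?thesis using assms summable_weighted_product[OF assms] by (auto intro!: summable_add summable_mult)
qed

lemma expectation_shifted_square:
  "integrable M (\<lambda>\<omega>. a j * (\<xi> j \<omega> + \<mu> j)\<^sup>2)"
  "expectation (\<lambda>\<omega>. a j * (\<xi> j \<omega> + \<mu> j)\<^sup>2) = a j + a j * (\<mu> j)\<^sup>2"
proof -
  have *: "(\<lambda>\<omega>. a j * (\<xi> j \<omega> + \<mu> j)\<^sup>2) = (\<lambda>\<omega>. a j * (\<xi> j \<omega>)\<^sup>2 + (2 * a j * \<mu> j) * \<xi> j \<omega> + a j * (\<mu> j)\<^sup>2)"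
    by (simp add: power2_eq_square algebra_simps)
  show "integrable M (\<lambda>\<omega>. a j * (\<xi> j \<omega> + \<mu> j)\<^sup>2)" unfolding * by simp
  show "expectation (\<lambda>\<omega>. a j * (\<xi> j \<omega> + \<mu> j)\<^sup>2) = a j + a j * (\<mu> j)\<^sup>2" unfolding * by (simp add: prob_space)
qed

lemma
  assumes "summable (\<lambda>j. a j * (\<mu> j)\<^sup>2)"
  shows AE_summable_chi_sq: "AE \<omega> in M. summable (\<lambda>j. a j * (\<xi> j \<omega> + \<mu> j)\<^sup>2)"
    and integrable_chi_sq: "integrable M (chi_sq a \<mu>)"
    and expectation_chi_sq: "expectation (chi_sq a \<mu>) = suminf a + (\<Sum>j. a j * (\<mu> j)\<^sup>2)"
proof -
  have nn: "0 \<le> a j * (\<xi> j \<omega> + \<mu> j)\<^sup>2" "0 \<le> a j + a j * (\<mu> j)\<^sup>2" for j \<omega>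
    using a_nonneg[of j] by simp_all
  have s: "(\<lambda>j. a j + a j * (\<mu> j)\<^sup>2) sums (suminf a + (\<Sum>j. a j * (\<mu> j)\<^sup>2))"
    using assms a_summable by (intro sums_add summable_sums)
  have "(\<integral>\<^sup>+\<omega>. (\<Sum>j. ennreal (a j * (\<xi> j \<omega> + \<mu> j)\<^sup>2)) \<partial>M) = (\<Sum>j. \<integral>\<^sup>+\<omega>. ennreal (a j * (\<xi> j \<omega> + \<mu> j)\<^sup>2) \<partial>M)"
    by (rule nn_integral_suminf) measurable
  also have "\<dots> = (\<Sum>j. ennreal (a j + a j * (\<mu> j)\<^sup>2))"
    using nn expectation_shifted_square[of _ \<mu>] by (subst nn_integral_eq_integral) auto
  also have "\<dots> \<noteq> \<infinity>"
    unfolding infinity_ennreal_def by (rule ennreal_suminf_neq_top[OF sums_summable[OF s] nn(2)])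
  finally have "AE \<omega> in M. (\<Sum>j. ennreal (a j * (\<xi> j \<omega> + \<mu> j)\<^sup>2)) \<noteq> \<infinity>"
    by (intro nn_integral_noteq_infinite) measurable
  then show AE: "AE \<omega> in M. summable (\<lambda>j. a j * (\<xi> j \<omega> + \<mu> j)\<^sup>2)"
    by eventually_elim (use nn in \<open>auto intro: summable_suminf_not_top\<close>)
  have norm_eq: "norm (a j * (\<xi> j \<omega> + \<mu> j)\<^sup>2) = a j * (\<xi> j \<omega> + \<mu> j)\<^sup>2" for j \<omega>
    using nn by simp
  have "AE \<omega> in M. summable (\<lambda>j. norm (a j * (\<xi> j \<omega> + \<mu> j)\<^sup>2))"
    unfolding norm_eq by (rule AE)
  note conv = expectation_shifted_square(1)[of _ \<mu>] this
  have sm: "summable (\<lambda>j. expectation (\<lambda>\<omega>. norm (a j * (\<xi> j \<omega> + \<mu> j)\<^sup>2)))"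
    unfolding norm_eq expectation_shifted_square(2)[of _ \<mu>] using s by (rule sums_summable)
  show "integrable M (chi_sq a \<mu>)"
    unfolding chi_sq_def by (rule integrable_suminf[OF conv sm])
  show "expectation (chi_sq a \<mu>) = suminf a + (\<Sum>j. a j * (\<mu> j)\<^sup>2)"
    unfolding chi_sq_def using integral_suminf[OF conv sm] s
    by (simp only: expectation_shifted_square(2)[of _ \<mu>] sums_iff)
qed

lemma
  assumes "summable (\<lambda>j. a j * (\<mu> j)\<^sup>2)"
  defines "Z \<equiv> \<lambda>\<omega>. chi_sq a \<mu> \<omega> - suminf a - (\<Sum>j. a j * (\<mu> j)\<^sup>2)"
  shows integrable_chi_sq_centred_sq: "integrable M (\<lambda>\<omega>. (Z \<omega>)\<^sup>2)"
    and expectation_chi_sq_centred_sq_le: "expectation (\<lambda>\<omega>. (Z \<omega>)\<^sup>2)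
      \<le> 2 * (\<Sum>j. (a j)\<^sup>2) + 4 * sqrt (\<Sum>j. (a j)\<^sup>2) * (\<Sum>j. a j * (\<mu> j)\<^sup>2)"
proof -
  have [measurable]: "random_variable borel Z" unfolding Z_def by measurable
  have sb: "summable (\<lambda>j. (2 * (a j * \<mu> j))\<^sup>2)"
    using summable_weights_sq_shift[OF assms(1)] by (simp add: power_mult_distrib summable_mult)
  have lim: "AE \<omega> in M. (\<lambda>j. a j * ((\<xi> j \<omega>)\<^sup>2 - 1) + 2 * (a j * \<mu> j) * \<xi> j \<omega>) sums Z \<omega>"
    using AE_summable_chi_sq[OF assms(1)]
  proof eventually_elim
    case (elim \<omega>)
    then have "(\<lambda>j. a j * (\<xi> j \<omega> + \<mu> j)\<^sup>2 - a j - a j * (\<mu> j)\<^sup>2) sums Z \<omega>"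
      unfolding Z_def chi_sq_def using a_summable assms(1) by (intro sums_diff summable_sums)
    then show ?case by (simp add: power2_eq_square algebra_simps)
  qed
  show "integrable M (\<lambda>\<omega>. (Z \<omega>)\<^sup>2)"
    by (rule integrable_chaos_limit_sq[OF summable_weights_sq sb _ lim]) measurable
  have "expectation (\<lambda>\<omega>. (Z \<omega>)\<^sup>2) \<le> 2 * (\<Sum>j. (a j)\<^sup>2) + (\<Sum>j. (2 * (a j * \<mu> j))\<^sup>2)"
    by (rule expectation_chaos_limit_sq_le[OF summable_weights_sq sb _ lim]) measurable
  also have "(\<Sum>j. (2 * (a j * \<mu> j))\<^sup>2) = 4 * (\<Sum>j. (a j * \<mu> j)\<^sup>2)"
    using summable_weights_sq_shift[OF assms(1)] by (simp add: power_mult_distrib suminf_mult)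
  finally show "expectation (\<lambda>\<omega>. (Z \<omega>)\<^sup>2)
      \<le> 2 * (\<Sum>j. (a j)\<^sup>2) + 4 * sqrt (\<Sum>j. (a j)\<^sup>2) * (\<Sum>j. a j * (\<mu> j)\<^sup>2)"
    using suminf_weights_sq_shift_le[OF assms(1)] by simp
qed

text \<open>
  The squares of the noise cancel in the difference, which leaves the linear term
  \<open>2 \<Sum> a\<^sub>j \<nu>\<^sub>j \<xi>\<^sub>j\<close> and a constant.  Hence the variance depends on \<open>\<nu>\<close> only.
\<close>

lemma chi_sq_shift_diff:
  assumes "summable (\<lambda>j. a j * (\<mu> j)\<^sup>2)" "summable (\<lambda>j. a j * (\<nu> j)\<^sup>2)"
  defines "d \<equiv> 2 * (\<Sum>j. a j * (\<mu> j * \<nu> j)) + (\<Sum>j. a j * (\<nu> j)\<^sup>2)"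
  defines "Z \<equiv> \<lambda>\<omega>. chi_sq a (\<lambda>j. \<mu> j + \<nu> j) \<omega> - chi_sq a \<mu> \<omega> - d"
  shows "integrable M (\<lambda>\<omega>. (Z \<omega>)\<^sup>2)"
    and "expectation (\<lambda>\<omega>. (Z \<omega>)\<^sup>2) \<le> 4 * sqrt (\<Sum>j. (a j)\<^sup>2) * (\<Sum>j. a j * (\<nu> j)\<^sup>2)"
proof -
  have [measurable]: "random_variable borel Z" unfolding Z_def by measurable
  have sb: "summable (\<lambda>j. (2 * (a j * \<nu> j))\<^sup>2)"
    using summable_weights_sq_shift[OF assms(2)] by (simp add: power_mult_distrib summable_mult)
  have d: "(\<lambda>j. 2 * (a j * (\<mu> j * \<nu> j)) + a j * (\<nu> j)\<^sup>2) sums d"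
    unfolding d_def using assms(2) summable_weighted_product[OF assms(1,2)]
    by (intro sums_add sums_mult summable_sums)
  have lim: "AE \<omega> in M. (\<lambda>j. 0 * ((\<xi> j \<omega>)\<^sup>2 - 1) + 2 * (a j * \<nu> j) * \<xi> j \<omega>) sums Z \<omega>"
    using AE_summable_chi_sq[OF assms(1)] AE_summable_chi_sq[OF summable_shift_add[OF assms(1,2)]]
  proof eventually_elim
    case (elim \<omega>)
    then have "(\<lambda>j. a j * (\<xi> j \<omega> + (\<mu> j + \<nu> j))\<^sup>2 - a j * (\<xi> j \<omega> + \<mu> j)\<^sup>2
        - (2 * (a j * (\<mu> j * \<nu> j)) + a j * (\<nu> j)\<^sup>2)) sums Z \<omega>"
      unfolding Z_def chi_sq_def by (intro sums_diff summable_sums d)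
    then show ?case by (simp add: power2_eq_square algebra_simps)
  qed
  have zero: "summable (\<lambda>j::nat. (0::real)\<^sup>2)" by simp
  show "integrable M (\<lambda>\<omega>. (Z \<omega>)\<^sup>2)"
    by (rule integrable_chaos_limit_sq[OF zero sb _ lim]) measurable
  have "expectation (\<lambda>\<omega>. (Z \<omega>)\<^sup>2) \<le> 2 * (\<Sum>j::nat. 0\<^sup>2) + (\<Sum>j. (2 * (a j * \<nu> j))\<^sup>2)"
    by (rule expectation_chaos_limit_sq_le[OF zero sb _ lim]) measurable
  also have "\<dots> = 4 * (\<Sum>j. (a j * \<nu> j)\<^sup>2)"
    using summable_weights_sq_shift[OF assms(2)] by (simp add: power_mult_distrib suminf_mult)
  finally show "expectation (\<lambda>\<omega>. (Z \<omega>)\<^sup>2) \<le> 4 * sqrt (\<Sum>j. (a j)\<^sup>2) * (\<Sum>j. a j * (\<nu> j)\<^sup>2)"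
    using suminf_weights_sq_shift_le[OF assms(2)] by simp
qed

text \<open>
  The factors of the characteristic function of a partial sum are bounded one by one, and the bound
  passes to the limit by dominated convergence.
\<close>

lemma cmod_char_chi_sq_le:
  assumes "summable (\<lambda>j. a j * (\<mu> j)\<^sup>2)"
  shows "cmod (char (distr M borel (chi_sq a \<mu>)) t) \<le> (1 + 4 * (\<Sum>j. (a j)\<^sup>2) * t\<^sup>2) powr (- 1 / 4)"
proof -
  define S where "S N \<omega> = (\<Sum>j<N. a j * (\<xi> j \<omega> + \<mu> j)\<^sup>2)" for N \<omega>
  have [measurable]: "random_variable borel (S N)" for N unfolding S_def by measurable
  have finite_bound: "cmod (CLINT \<omega>|M. iexp (t * S N \<omega>)) \<le> (1 + 4 * t\<^sup>2 * (\<Sum>j<N. (a j)\<^sup>2)) powr (- 1 / 4)" for N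
  proof -
    have pos: "0 < 1 + 4 * (t * a j)\<^sup>2" for j by (rule add_pos_nonneg) auto
    have factor: "cmod (char (distr M borel (\<lambda>\<omega>. a j * (\<xi> j \<omega> + \<mu> j)\<^sup>2)) t) \<le> (1 + 4 * (t * a j)\<^sup>2) powr (- 1 / 4)" for j
    proof -
      have "char (distr M borel (\<lambda>\<omega>. a j * (\<xi> j \<omega> + \<mu> j)\<^sup>2)) t
          = (CLINT x|distr M borel (\<xi> j). iexp ((t * a j) * (x + \<mu> j)\<^sup>2))"
        unfolding char_def by (subst (1 2) integral_distr) (simp_all add: mult_ac)
      then have "(cmod (char (distr M borel (\<lambda>\<omega>. a j * (\<xi> j \<omega> + \<mu> j)\<^sup>2)) t))\<^sup>2 \<le> 1 / sqrt (1 + 4 * (t * a j)\<^sup>2)"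
        by (simp only: distr_xi cmod_integral_iexp_shifted_square)
      also have "\<dots> = ((1 + 4 * (t * a j)\<^sup>2) powr (- 1 / 4))\<^sup>2"
        using pos[of j] by (simp add: powr_half_sqrt[symmetric] power2_eq_square powr_add[symmetric])
          (simp add: powr_minus_divide)
      finally show ?thesis by (rule power2_le_imp_le) simp
    qed
    have "indep_vars (\<lambda>_. borel) (\<lambda>j \<omega>. a j * (\<xi> j \<omega> + \<mu> j)\<^sup>2) {..<N}"
      using indep_vars_compose2[OF indep_vars_subset[OF indep], of "{..<N}" "\<lambda>j x. a j * (x + \<mu> j)\<^sup>2" "\<lambda>_. borel"] by simp
    from char_distr_sum[OF this, of t]
    have "(CLINT \<omega>|M. iexp (t * S N \<omega>)) = (\<Prod>j<N. char (distr M borel (\<lambda>\<omega>. a j * (\<xi> j \<omega> + \<mu> j)\<^sup>2)) t)"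
      by (simp only: S_def[symmetric]) (simp add: char_def integral_distr)
    then have "cmod (CLINT \<omega>|M. iexp (t * S N \<omega>)) = (\<Prod>j<N. cmod (char (distr M borel (\<lambda>\<omega>. a j * (\<xi> j \<omega> + \<mu> j)\<^sup>2)) t))"
      by (simp only: prod_norm)
    also have "\<dots> \<le> (\<Prod>j<N. (1 + 4 * (t * a j)\<^sup>2) powr (- 1 / 4))"
      by (intro prod_mono conjI norm_ge_zero factor)
    also have "\<dots> = (\<Prod>j<N. 1 + 4 * (t * a j)\<^sup>2) powr (- 1 / 4)"
      by (rule prod_powr_distrib[symmetric])
    also have "\<dots> \<le> (1 + (\<Sum>j<N. 4 * (t * a j)\<^sup>2)) powr (- 1 / 4)"
      by (intro powr_mono2' add_pos_nonneg sum_nonneg one_plus_sum_le_prod) auto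
    finally show ?thesis by (simp add: power_mult_distrib sum_distrib_left mult_ac)
  qed
  have "(\<lambda>N. CLINT \<omega>|M. iexp (t * S N \<omega>)) \<longlonglongrightarrow> (CLINT \<omega>|M. iexp (t * chi_sq a \<mu> \<omega>))"
  proof (rule integral_dominated_convergence[where w="\<lambda>_. 1"])
    show "AE \<omega> in M. (\<lambda>N. iexp (t * S N \<omega>)) \<longlonglongrightarrow> iexp (t * chi_sq a \<mu> \<omega>)"
      using AE_summable_chi_sq[OF assms]
    proof eventually_elim
      case (elim \<omega>)
      then have "(\<lambda>N. S N \<omega>) \<longlonglongrightarrow> chi_sq a \<mu> \<omega>"
        unfolding S_def chi_sq_def by (rule summable_LIMSEQ)
      then show ?case by (intro tendsto_intros)
    qed
  qed (auto simp del: of_real_mult)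
  then have "(\<lambda>N. cmod (CLINT \<omega>|M. iexp (t * S N \<omega>))) \<longlonglongrightarrow> cmod (CLINT \<omega>|M. iexp (t * chi_sq a \<mu> \<omega>))"
    by (rule tendsto_norm)
  moreover have "(\<lambda>N. (1 + 4 * t\<^sup>2 * (\<Sum>j<N. (a j)\<^sup>2)) powr (- 1 / 4))
      \<longlonglongrightarrow> (1 + 4 * t\<^sup>2 * (\<Sum>j. (a j)\<^sup>2)) powr (- 1 / 4)"
  proof (rule tendsto_powr)
    show "(\<lambda>N. 1 + 4 * t\<^sup>2 * (\<Sum>j<N. (a j)\<^sup>2)) \<longlonglongrightarrow> 1 + 4 * t\<^sup>2 * (\<Sum>j. (a j)\<^sup>2)"
      by (intro tendsto_intros summable_LIMSEQ summable_weights_sq)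
    have "0 \<le> 4 * t\<^sup>2 * (\<Sum>j. (a j)\<^sup>2)"
      using suminf_nonneg[OF summable_weights_sq] by simp
    then show "1 + 4 * t\<^sup>2 * (\<Sum>j. (a j)\<^sup>2) \<noteq> 0" by linarith
  qed (rule tendsto_const)
  ultimately have "cmod (CLINT \<omega>|M. iexp (t * chi_sq a \<mu> \<omega>)) \<le> (1 + 4 * t\<^sup>2 * (\<Sum>j. (a j)\<^sup>2)) powr (- 1 / 4)"
    by (rule LIMSEQ_le) (intro exI allI impI finite_bound)
  then show ?thesis by (simp add: char_def integral_distr mult_ac)
qed

lemma prob_chi_sq_interval_le:
  assumes "summable (\<lambda>j. a j * (\<mu> j)\<^sup>2)" "0 < \<delta>"
  shows "prob {\<omega> \<in> space M. \<bar>chi_sq a \<mu> \<omega> - x\<bar> \<le> \<delta>}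
    \<le> exp (1 / 2) * (sqrt \<delta> + (1 + 4 * (\<Sum>j. (a j)\<^sup>2) / \<delta>) powr (- 1 / 4))"
proof -
  interpret D: real_distribution "distr M borel (chi_sq a \<mu>)"
    by (rule real_distribution_distr) measurable
  have "prob {\<omega> \<in> space M. \<bar>chi_sq a \<mu> \<omega> - x\<bar> \<le> \<delta>} = measure (distr M borel (chi_sq a \<mu>)) {x - \<delta>..x + \<delta>}"
    by (subst measure_distr) (auto intro!: arg_cong[where f=prob] simp: abs_le_iff)
  also have "\<dots> \<le> exp (1 / 2) * (sqrt \<delta> + (1 + 4 * (\<Sum>j. (a j)\<^sup>2) / \<delta>) powr (- 1 / 4))"
    using assms suminf_nonneg[OF summable_weights_sq]
    by (intro D.measure_interval_le_of_char_decay cmod_char_chi_sq_le) auto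
  finally show ?thesis .
qed

end
end

context std_normal_sequence begin

context
  fixes a :: "nat \<Rightarrow> real" and C :: real
  assumes a_nonneg: "\<And>j. 0 \<le> a j" and a_summable: "summable a"
    and C: "0 < C" "(\<Sum>j. (a j)\<^sup>2) \<le> C"
begin

lemma
  assumes "summable (\<lambda>j. a j * (\<mu> j)\<^sup>2)"
  defines "R \<equiv> \<Sum>j. a j * (\<mu> j)\<^sup>2"
  shows integrable_chi_sq_centred: "integrable M (\<lambda>\<omega>. (chi_sq a \<mu> \<omega> - suminf a - R)\<^sup>2)"
    and variance_chi_sq_le: "expectation (\<lambda>\<omega>. (chi_sq a \<mu> \<omega> - suminf a - R)\<^sup>2) \<le> 2 * C + 4 * sqrt C * R"
proof -
  have R: "0 \<le> R" unfolding R_def using assms a_nonneg by (intro suminf_nonneg) auto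
  show "integrable M (\<lambda>\<omega>. (chi_sq a \<mu> \<omega> - suminf a - R)\<^sup>2)"
    unfolding R_def by (rule integrable_chi_sq_centred_sq[OF a_nonneg a_summable assms(1)])
  have "expectation (\<lambda>\<omega>. (chi_sq a \<mu> \<omega> - suminf a - R)\<^sup>2) \<le> 2 * (\<Sum>j. (a j)\<^sup>2) + 4 * sqrt (\<Sum>j. (a j)\<^sup>2) * R"
    unfolding R_def by (rule expectation_chi_sq_centred_sq_le[OF a_nonneg a_summable assms(1)])
  also have "\<dots> \<le> 2 * C + 4 * sqrt C * R"
    using C R by (intro add_mono mult_right_mono mult_left_mono) auto
  finally show "expectation (\<lambda>\<omega>. (chi_sq a \<mu> \<omega> - suminf a - R)\<^sup>2) \<le> 2 * C + 4 * sqrt C * R" .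
qed

lemma prob_chi_sq_null_upper_tail:
  assumes "0 < t"
  shows "prob {\<omega> \<in> space M. t < chi_sq a (\<lambda>_. 0) \<omega> - suminf a} \<le> 2 * C / t\<^sup>2"
proof -
  let ?Z = "\<lambda>\<omega>. chi_sq a (\<lambda>_. 0) \<omega> - suminf a"
  have "prob {\<omega> \<in> space M. t < ?Z \<omega>} \<le> prob {\<omega> \<in> space M. t \<le> \<bar>?Z \<omega>\<bar>}"
    by (intro finite_measure_mono) auto
  also have "\<dots> \<le> expectation (\<lambda>\<omega>. (?Z \<omega>)\<^sup>2) / t\<^sup>2"
    using integrable_chi_sq_centred[of "\<lambda>_. 0"] assms by (intro second_moment_method) auto
  also have "\<dots> \<le> 2 * C / t\<^sup>2"
    using variance_chi_sq_le[of "\<lambda>_. 0"] by (intro divide_right_mono) auto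
  finally show ?thesis .
qed

text \<open>
  Under a signal of size \<open>R \<ge> 1\<close> the centred sum has mean \<open>R\<close> and variance \<open>O(R)\<close>, so that values below \<open>R / 2\<close> have
  probability \<open>O(1 / R)\<close>.
\<close>

lemma prob_chi_sq_lower_tail:
  assumes "summable (\<lambda>j. a j * (\<mu> j)\<^sup>2)"
  defines "R \<equiv> \<Sum>j. a j * (\<mu> j)\<^sup>2"
  assumes "1 \<le> R" "2 * t \<le> R"
  shows "prob {\<omega> \<in> space M. chi_sq a \<mu> \<omega> - suminf a \<le> t} \<le> (8 * C + 16 * sqrt C) / R"
proof -
  let ?Z = "\<lambda>\<omega>. chi_sq a \<mu> \<omega> - suminf a - R"
  have "prob {\<omega> \<in> space M. chi_sq a \<mu> \<omega> - suminf a \<le> t} \<le> prob {\<omega> \<in> space M. R / 2 \<le> \<bar>?Z \<omega>\<bar>}"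
    using assms(3,4) by (intro finite_measure_mono) auto
  also have "\<dots> \<le> expectation (\<lambda>\<omega>. (?Z \<omega>)\<^sup>2) / (R / 2)\<^sup>2"
    using integrable_chi_sq_centred[OF assms(1)] assms(3) unfolding R_def by (intro second_moment_method) auto
  also have "\<dots> \<le> (2 * C + 4 * sqrt C * R) / (R / 2)\<^sup>2"
    using variance_chi_sq_le[OF assms(1)] unfolding R_def by (intro divide_right_mono) auto
  also have "\<dots> \<le> (2 * C * R + 4 * sqrt C * R) / (R / 2)\<^sup>2"
    using assms(3) C by (intro divide_right_mono add_right_mono) auto
  also have "\<dots> = (8 * C + 16 * sqrt C) / R"
    using assms(3) by (simp add: power2_eq_square field_simps)
  finally show ?thesis .
qed

text \<open>
  The second moment of the statistic under \<open>\<nu>\<close> is \<open>O(1 + R\<^sup>2)\<close>, hence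
  \<open>expectation_diff_le_of_cdf_diff_le\<close> yields \<open>R\<^sup>2 \<le> \<eta> O(1 + R\<^sup>2)\<close>.  For small \<open>\<eta>\<close> the term with \<open>R\<^sup>2\<close> is
  absorbed on the left; the value \<open>1 / 48\<close> makes it at most half of the left-hand side.
\<close>

lemma signal_sq_le_of_cdf_diff_le:
  assumes "summable (\<lambda>j. a j * (\<nu> j)\<^sup>2)"
  defines "R \<equiv> \<Sum>j. a j * (\<nu> j)\<^sup>2"
  assumes "0 < \<eta>" "\<eta> \<le> 1 / 48"
    and cdf: "\<And>t. prob {\<omega> \<in> space M. chi_sq a (\<lambda>_. 0) \<omega> - suminf a \<le> t}
        - prob {\<omega> \<in> space M. chi_sq a \<nu> \<omega> - suminf a \<le> t} \<le> \<eta>"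
  shows "R\<^sup>2 \<le> 96 * C * \<eta>"
proof -
  have R: "0 \<le> R" unfolding R_def using assms(1) a_nonneg by (intro suminf_nonneg) auto
  have int0: "integrable M (chi_sq a (\<lambda>_. 0))" and E0: "expectation (chi_sq a (\<lambda>_. 0)) = suminf a"
    using integrable_chi_sq[OF a_nonneg a_summable, of "\<lambda>_. 0"] expectation_chi_sq[OF a_nonneg a_summable, of "\<lambda>_. 0"]
    by auto
  have int1: "integrable M (chi_sq a \<nu>)" and E1: "expectation (chi_sq a \<nu>) = suminf a + R"
    using integrable_chi_sq[OF a_nonneg a_summable assms(1)] expectation_chi_sq[OF a_nonneg a_summable assms(1)]
    by (auto simp: R_def)
  let ?X = "\<lambda>\<omega>. chi_sq a (\<lambda>_. 0) \<omega> - suminf a" and ?Y = "\<lambda>\<omega>. chi_sq a \<nu> \<omega> - suminf a"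
  note cent = integrable_chi_sq_centred[OF assms(1), folded R_def]
  have intc: "integrable M (\<lambda>\<omega>. chi_sq a \<nu> \<omega> - suminf a - R)" using int1 by simp
  have Y2: "(?Y \<omega>)\<^sup>2 = (chi_sq a \<nu> \<omega> - suminf a - R)\<^sup>2 + 2 * R * (chi_sq a \<nu> \<omega> - suminf a - R) + R\<^sup>2" for \<omega>
    by (simp add: power2_eq_square algebra_simps)
  have intY2: "integrable M (\<lambda>\<omega>. (?Y \<omega>)\<^sup>2)"
    unfolding Y2 using cent intc by simp
  have EY2: "expectation (\<lambda>\<omega>. (?Y \<omega>)\<^sup>2) \<le> 2 * C + 4 * sqrt C * R + R\<^sup>2"
  proof -
    have "expectation (\<lambda>\<omega>. chi_sq a \<nu> \<omega> - suminf a - R) = 0" using int1 by (simp add: E1 prob_space)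
    then have "expectation (\<lambda>\<omega>. (?Y \<omega>)\<^sup>2) = expectation (\<lambda>\<omega>. (chi_sq a \<nu> \<omega> - suminf a - R)\<^sup>2) + R\<^sup>2"
      unfolding Y2 using cent intc by (simp add: prob_space del: Bochner_Integration.integral_diff)
    then show ?thesis using variance_chi_sq_le[OF assms(1)] by (simp add: R_def)
  qed
  have X2: "integrable M (\<lambda>\<omega>. (?X \<omega>)\<^sup>2)" "expectation (\<lambda>\<omega>. (?X \<omega>)\<^sup>2) \<le> 2 * C"
    using integrable_chi_sq_centred[of "\<lambda>_. 0"] variance_chi_sq_le[of "\<lambda>_. 0"] by auto
  define m where "m = 4 * C + 4 * sqrt C * R + R\<^sup>2"
  have "0 < m" unfolding m_def using C R by (intro add_pos_nonneg) auto
  have "expectation ?Y - expectation ?X \<le> 2 * sqrt (2 * \<eta> * m)"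
    using X2 intY2 EY2 cdf \<open>0 < m\<close> \<open>0 < \<eta>\<close>
    by (intro expectation_diff_le_of_cdf_diff_le) (auto simp: m_def)
  then have "R \<le> 2 * sqrt (2 * \<eta> * m)" using int0 int1 by (simp add: E0 E1 prob_space)
  then have "R\<^sup>2 \<le> (2 * sqrt (2 * \<eta> * m))\<^sup>2" using R by (intro power_mono)
  also have "\<dots> = 8 * \<eta> * m" using \<open>0 < m\<close> \<open>0 < \<eta>\<close> by (simp add: power_mult_distrib)
  also have "m \<le> 6 * C + 3 * R\<^sup>2"
    using sum_squares_bound[of "sqrt C" R] C by (simp add: m_def)
  then have "8 * \<eta> * m \<le> 8 * \<eta> * (6 * C + 3 * R\<^sup>2)" using \<open>0 < \<eta>\<close> by (intro mult_left_mono) auto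
  also have "\<dots> = 48 * C * \<eta> + 24 * \<eta> * R\<^sup>2" by (simp add: algebra_simps)
  also have "24 * \<eta> * R\<^sup>2 \<le> 1 / 2 * R\<^sup>2" using \<open>\<eta> \<le> 1 / 48\<close> by (intro mult_right_mono) auto
  finally show ?thesis by simp
qed

text \<open>
  The two events differ only if the unperturbed variable is within \<open>\<delta>\<close> of the threshold or the
  perturbation exceeds \<open>\<delta>\<close>; the assumption on the constant part leaves \<open>\<delta> / 2\<close> for the linear
  Gaussian part of the perturbation.
\<close>

lemma prob_chi_sq_shift_le:
  assumes sm: "summable (\<lambda>j. a j * (\<mu> j)\<^sup>2)" "summable (\<lambda>j. a j * (\<nu> j)\<^sup>2)"
  assumes "0 < \<delta>"
    and d: "\<bar>2 * (\<Sum>j. a j * (\<mu> j * \<nu> j)) + (\<Sum>j. a j * (\<nu> j)\<^sup>2)\<bar> \<le> \<delta> / 2"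
  shows "\<bar>prob {\<omega> \<in> space M. chi_sq a \<mu> \<omega> - suminf a \<le> t}
        - prob {\<omega> \<in> space M. chi_sq a (\<lambda>j. \<mu> j + \<nu> j) \<omega> - suminf a \<le> t}\<bar>
      \<le> exp (1 / 2) * (sqrt \<delta> + (1 + 4 * (\<Sum>j. (a j)\<^sup>2) / \<delta>) powr (- 1 / 4))
        + 16 * sqrt C * (\<Sum>j. a j * (\<nu> j)\<^sup>2) / \<delta>\<^sup>2"
proof -
  define e where "e = 2 * (\<Sum>j. a j * (\<mu> j * \<nu> j)) + (\<Sum>j. a j * (\<nu> j)\<^sup>2)"
  let ?Q = "chi_sq a \<mu>" and ?Q' = "chi_sq a (\<lambda>j. \<mu> j + \<nu> j)"
  let ?Z = "\<lambda>\<omega>. ?Q' \<omega> - ?Q \<omega> - e"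
  let ?near = "{\<omega> \<in> space M. \<bar>?Q \<omega> - (suminf a + t)\<bar> \<le> \<delta>}"
  let ?far = "{\<omega> \<in> space M. \<delta> / 2 \<le> \<bar>?Z \<omega>\<bar>}"
  let ?A = "{\<omega> \<in> space M. ?Q \<omega> - suminf a \<le> t}" and ?B = "{\<omega> \<in> space M. ?Q' \<omega> - suminf a \<le> t}"
  have near_or_far: "\<bar>?Q \<omega> - (suminf a + t)\<bar> \<le> \<delta> \<or> \<delta> / 2 \<le> \<bar>?Z \<omega>\<bar>"
    if "(?Q \<omega> - suminf a \<le> t) \<noteq> (?Q' \<omega> - suminf a \<le> t)" for \<omega>
  proof (rule ccontr)
    assume *: "\<not> ?thesis"
    then have "\<bar>?Q' \<omega> - ?Q \<omega>\<bar> < \<delta>"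
      using d[folded e_def] abs_triangle_ineq[of "?Z \<omega>" e] by simp
    moreover have "\<bar>?Q \<omega> - (suminf a + t)\<bar> \<le> \<bar>?Q' \<omega> - ?Q \<omega>\<bar>"
      using that by (cases "?Q \<omega> - suminf a \<le> t") (simp_all add: abs_if)
    ultimately show False using * by simp
  qed
  have sub: "?A \<subseteq> ?B \<union> (?near \<union> ?far)" "?B \<subseteq> ?A \<union> (?near \<union> ?far)"
    using near_or_far by blast+
  have un: "prob (?near \<union> ?far) \<le> prob ?near + prob ?far"
    by (rule measure_Un_le) measurable
  have meas: "?A \<in> events" "?B \<in> events" "?near \<union> ?far \<in> events" by measurable
  have "prob ?A \<le> prob ?B + prob (?near \<union> ?far)" "prob ?B \<le> prob ?A + prob (?near \<union> ?far)"
    using finite_measure_mono[OF sub(1)] finite_measure_mono[OF sub(2)] meas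
      measure_Un_le[of ?B M "?near \<union> ?far"] measure_Un_le[of ?A M "?near \<union> ?far"] by auto
  then have "\<bar>prob ?A - prob ?B\<bar> \<le> prob ?near + prob ?far" using un by linarith
  also have "prob ?near \<le> exp (1 / 2) * (sqrt \<delta> + (1 + 4 * (\<Sum>j. (a j)\<^sup>2) / \<delta>) powr (- 1 / 4))"
    by (rule prob_chi_sq_interval_le[OF a_nonneg a_summable sm(1) \<open>0 < \<delta>\<close>])
  also have "prob ?far \<le> expectation (\<lambda>\<omega>. (?Z \<omega>)\<^sup>2) / (\<delta> / 2)\<^sup>2"
    using chi_sq_shift_diff(1)[OF a_nonneg a_summable sm] \<open>0 < \<delta>\<close>
    by (intro second_moment_method) (auto simp: e_def)
  also have "\<dots> \<le> 4 * sqrt (\<Sum>j. (a j)\<^sup>2) * (\<Sum>j. a j * (\<nu> j)\<^sup>2) / (\<delta> / 2)\<^sup>2"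
    using chi_sq_shift_diff(2)[OF a_nonneg a_summable sm] by (intro divide_right_mono) (auto simp: e_def)
  also have "\<dots> \<le> 4 * sqrt C * (\<Sum>j. a j * (\<nu> j)\<^sup>2) / (\<delta> / 2)\<^sup>2"
    using C a_nonneg sm(2) by (intro divide_right_mono mult_right_mono mult_left_mono suminf_nonneg) auto
  also have "\<dots> = 16 * sqrt C * (\<Sum>j. a j * (\<nu> j)\<^sup>2) / \<delta>\<^sup>2"
    by (simp add: power2_eq_square)
  finally show ?thesis by simp
qed

end
end

section \<open>Triangular arrays of weights\<close>

text \<open>
  The bound tends to 0 with \<open>\<delta>\<close> and decreases in \<open>B\<close>, hence one radius serves all weights whose sum
  of squares is at least \<open>A\<close>.
\<close>

lemma ex_small_ball_radius:
  assumes "0 < A" "0 < \<epsilon>"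
  shows "\<exists>\<delta>>0. \<forall>B\<ge>A. exp (1 / 2) * (sqrt \<delta> + (1 + 4 * B / \<delta>) powr (- 1 / 4)) \<le> \<epsilon>"
proof -
  have "((\<lambda>\<delta>. exp (1 / 2) * (sqrt \<delta> + (1 + 4 * A / \<delta>) powr (- 1 / 4))) \<longlongrightarrow> exp (1 / 2) * (sqrt 0 + 0)) (at_right 0)"
  proof (intro tendsto_intros)
    have "filterlim (\<lambda>\<delta>. 4 * A / \<delta>) at_top (at_right 0)"
      using \<open>0 < A\<close>
      unfolding divide_inverse
      by (intro filterlim_tendsto_pos_mult_at_top[OF tendsto_const _ filterlim_inverse_at_top_right]) simp
    then have "filterlim (\<lambda>\<delta>. 1 + 4 * A / \<delta>) at_top (at_right 0)"
      by (intro filterlim_tendsto_add_at_top[OF tendsto_const])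
    then show "((\<lambda>\<delta>. (1 + 4 * A / \<delta>) powr (- 1 / 4)) \<longlongrightarrow> 0) (at_right 0)"
      by (intro tendsto_neg_powr) auto
  qed
  then have "eventually (\<lambda>\<delta>. exp (1 / 2) * (sqrt \<delta> + (1 + 4 * A / \<delta>) powr (- 1 / 4)) < \<epsilon>) (at_right 0)"
    using \<open>0 < \<epsilon>\<close> by (intro order_tendstoD(2)) auto
  then have "eventually (\<lambda>\<delta>. exp (1 / 2) * (sqrt \<delta> + (1 + 4 * A / \<delta>) powr (- 1 / 4)) < \<epsilon> \<and> 0 < \<delta>) (at_right 0)"
    by (intro eventually_conj eventually_at_right_less)
  then obtain \<delta> where \<delta>: "0 < \<delta>" "exp (1 / 2) * (sqrt \<delta> + (1 + 4 * A / \<delta>) powr (- 1 / 4)) < \<epsilon>"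
    using eventually_happens'[OF trivial_limit_at_right_real] by blast
  show ?thesis
  proof (intro exI[of _ \<delta>] conjI allI impI \<delta>(1))
    fix B assume "A \<le> B"
    then have "4 * A / \<delta> \<le> 4 * B / \<delta>" using \<delta>(1) by (intro divide_right_mono) auto
    moreover have "0 < 4 * A / \<delta>" using \<open>0 < A\<close> \<delta>(1) by simp
    ultimately have "(1 + 4 * B / \<delta>) powr (- 1 / 4) \<le> (1 + 4 * A / \<delta>) powr (- 1 / 4)"
      by (intro powr_mono2') auto
    then have "exp (1 / 2) * (sqrt \<delta> + (1 + 4 * B / \<delta>) powr (- 1 / 4))
        \<le> exp (1 / 2) * (sqrt \<delta> + (1 + 4 * A / \<delta>) powr (- 1 / 4))"
      by (intro mult_left_mono add_left_mono) auto
    then show "exp (1 / 2) * (sqrt \<delta> + (1 + 4 * B / \<delta>) powr (- 1 / 4)) \<le> \<epsilon>" using \<delta>(2) by linarith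
  qed
qed

context std_normal_sequence begin

text \<open>
  Thresholds are measured from \<open>\<Sum> a\<^sub>j\<close>, the mean of the sum in the absence of a signal.
\<close>

definition centred_chi_sq_cdf :: "(nat \<Rightarrow> real) \<Rightarrow> (nat \<Rightarrow> real) \<Rightarrow> real \<Rightarrow> real" where
  "centred_chi_sq_cdf a \<mu> t = prob {\<omega> \<in> space M. chi_sq a \<mu> \<omega> - suminf a \<le> t}"

lemma prob_gt_eq_centred_chi_sq_cdf:
  "prob {\<omega> \<in> space M. t < chi_sq a \<mu> \<omega> - suminf a} = 1 - centred_chi_sq_cdf a \<mu> t"
  unfolding centred_chi_sq_cdf_def by (subst prob_compl[symmetric]) (auto intro!: arg_cong[where f=prob])

context
  fixes a :: "nat \<Rightarrow> nat \<Rightarrow> real" and C :: real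
  assumes weights: "\<And>n j. 1 \<le> n \<Longrightarrow> 0 \<le> a n j" "\<And>n. 1 \<le> n \<Longrightarrow> summable (a n)"
    and C: "0 < C" "\<And>n. 1 \<le> n \<Longrightarrow> (\<Sum>j. (a n j)\<^sup>2) \<le> C"
begin

text \<open>
  Beyond \<open>\<surd>(4 C / \<alpha>)\<close>, Chebyshev's inequality leaves the null statistic a tail of at most \<open>\<alpha> / 2\<close>.
\<close>

lemma critical_values_eventually_le:
  assumes "0 < \<alpha>" and lim: "(\<lambda>n. centred_chi_sq_cdf (a n) (\<lambda>_. 0) (t n)) \<longlonglongrightarrow> 1 - \<alpha>"
  shows "eventually (\<lambda>n. t n \<le> sqrt (4 * C / \<alpha>)) sequentially"
proof -
  have "eventually (\<lambda>n. centred_chi_sq_cdf (a n) (\<lambda>_. 0) (t n) < 1 - \<alpha> / 2) sequentially"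
    using \<open>0 < \<alpha>\<close> by (intro order_tendstoD(2)[OF lim]) auto
  with eventually_ge_at_top[of 1] show ?thesis
  proof eventually_elim
    case (elim n)
    show ?case
    proof (rule ccontr)
      define s where "s = sqrt (4 * C / \<alpha>)"
      have s: "0 < s" "s\<^sup>2 = 4 * C / \<alpha>" using C(1) \<open>0 < \<alpha>\<close> by (simp_all add: s_def)
      assume "\<not> ?thesis"
      then have "s < t n" by (simp add: s_def)
      then have "s\<^sup>2 \<le> (t n)\<^sup>2" using s by (intro power_mono) auto
      have "1 - centred_chi_sq_cdf (a n) (\<lambda>_. 0) (t n) \<le> 2 * C / (t n)\<^sup>2"
        using prob_chi_sq_null_upper_tail[OF weights(1)[OF elim(1)] weights(2)[OF elim(1)] C(1) C(2)[OF elim(1)], of "t n"]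
          \<open>s < t n\<close> s(1) by (simp add: prob_gt_eq_centred_chi_sq_cdf)
      also have "\<dots> \<le> 2 * C / s\<^sup>2"
        using \<open>s\<^sup>2 \<le> (t n)\<^sup>2\<close> \<open>s < t n\<close> s(1) C(1) by (intro divide_left_mono mult_pos_pos) auto
      also have "\<dots> = \<alpha> / 2" using C(1) \<open>0 < \<alpha>\<close> by (simp add: s(2))
      finally show False using elim(2) by simp
    qed
  qed
qed

lemma signal_tendsto_zero:
  assumes \<nu>: "\<And>n. 1 \<le> n \<Longrightarrow> summable (\<lambda>j. a n j * (\<nu> n j)\<^sup>2)"
    and undetected: "\<And>\<eta>. 0 < \<eta> \<Longrightarrow> eventually (\<lambda>n. \<forall>t. centred_chi_sq_cdf (a n) (\<lambda>_. 0) t - centred_chi_sq_cdf (a n) (\<nu> n) t \<le> \<eta>) sequentially"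
  shows "(\<lambda>n. \<Sum>j. a n j * (\<nu> n j)\<^sup>2) \<longlonglongrightarrow> 0"
proof (rule LIMSEQ_I)
  fix \<epsilon> :: real assume "0 < \<epsilon>"
  define \<eta> where "\<eta> = min (1 / 48) (\<epsilon>\<^sup>2 / (192 * C))"
  have \<eta>: "0 < \<eta>" "\<eta> \<le> 1 / 48" using \<open>0 < \<epsilon>\<close> C(1) by (simp_all add: \<eta>_def)
  have "96 * C * \<eta> \<le> 96 * C * (\<epsilon>\<^sup>2 / (192 * C))" using C(1) by (intro mult_left_mono) (auto simp: \<eta>_def)
  also have "\<dots> = \<epsilon>\<^sup>2 / 2" using C(1) by simp
  also have "\<dots> < \<epsilon>\<^sup>2" using \<open>0 < \<epsilon>\<close> by simp
  finally have small: "96 * C * \<eta> < \<epsilon>\<^sup>2" .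
  have "eventually (\<lambda>n. norm ((\<Sum>j. a n j * (\<nu> n j)\<^sup>2) - 0) < \<epsilon>) sequentially"
    using undetected[OF \<eta>(1)] eventually_ge_at_top[of 1]
  proof eventually_elim
    case (elim n)
    have "(\<Sum>j. a n j * (\<nu> n j)\<^sup>2)\<^sup>2 \<le> 96 * C * \<eta>"
      using elim \<eta> C by (intro signal_sq_le_of_cdf_diff_le weights \<nu>) (auto simp: centred_chi_sq_cdf_def)
    then have "\<bar>\<Sum>j. a n j * (\<nu> n j)\<^sup>2\<bar>\<^sup>2 < \<epsilon>\<^sup>2" using small by simp
    from power_less_imp_less_base[OF this] show ?case using \<open>0 < \<epsilon>\<close> by simp
  qed
  then show "\<exists>N. \<forall>n\<ge>N. norm ((\<Sum>j. a n j * (\<nu> n j)\<^sup>2) - 0) < \<epsilon>"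
    by (simp add: eventually_sequentially)
qed

text \<open>
  Signals of bounded size are treated by anticoncentration, large ones by showing that both
  probabilities vanish.  The cut between the two regimes is fixed before the anticoncentration radius,
  and \<open>n\<close> is taken large last.
\<close>

lemma centred_chi_sq_cdf_shift_tendsto_zero:
  assumes b: "0 < b" "\<And>n. 1 \<le> n \<Longrightarrow> b \<le> (\<Sum>j. (a n j)\<^sup>2)"
    and \<mu>: "\<And>n. 1 \<le> n \<Longrightarrow> summable (\<lambda>j. a n j * (\<mu> n j)\<^sup>2)"
    and \<nu>: "\<And>n. 1 \<le> n \<Longrightarrow> summable (\<lambda>j. a n j * (\<nu> n j)\<^sup>2)"
    and t: "eventually (\<lambda>n. t n \<le> G) sequentially"
    and lim: "(\<lambda>n. \<Sum>j. a n j * (\<nu> n j)\<^sup>2) \<longlonglongrightarrow> 0"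
  shows "(\<lambda>n. centred_chi_sq_cdf (a n) (\<mu> n) (t n) - centred_chi_sq_cdf (a n) (\<lambda>j. \<mu> n j + \<nu> n j) (t n)) \<longlonglongrightarrow> 0"
proof (rule LIMSEQ_I)
  fix \<epsilon> :: real assume "0 < \<epsilon>"
  \<comment> \<open>\<open>R(\<mu>) \<ge> 2 B + 1\<close> will count as a large signal.  Then \<open>R(\<mu> + \<nu>) \<ge> B\<close> once \<open>R(\<nu>) < 1 / 2\<close>,
    and signals of size at least \<open>B\<close> are missed with probability at most \<open>\<epsilon> / 2\<close>.\<close>
  define D where "D = 8 * C + 16 * sqrt C"
  define B where "B = Max {1, 2 * G, 2 * D / \<epsilon>}"
  have B: "1 \<le> B" "2 * G \<le> B" "2 * D / \<epsilon> \<le> B" by (simp_all add: B_def)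
  have "0 \<le> D" using C(1) by (simp add: D_def)
  have DB: "D / B \<le> \<epsilon> / 2" using B \<open>0 < \<epsilon>\<close> by (simp add: field_simps)
  obtain \<delta> where \<delta>: "0 < \<delta>"
    and ball: "\<And>A. b \<le> A \<Longrightarrow> exp (1 / 2) * (sqrt \<delta> + (1 + 4 * A / \<delta>) powr (- 1 / 4)) \<le> \<epsilon> / 2"
    using ex_small_ball_radius[OF b(1), of "\<epsilon> / 2"] \<open>0 < \<epsilon>\<close> by auto
  \<comment> \<open>Weight in the inequality \<open>2 \<bar>\<mu>\<nu>\<bar> \<le> \<tau> \<mu>\<^sup>2 + \<nu>\<^sup>2 / \<tau>\<close> for the cross term; as long as
    \<open>R(\<mu>) \<le> 2 B + 1\<close> it makes the contribution of \<open>\<mu>\<close> at most \<open>\<delta> / 8\<close>.\<close>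
  define \<tau> where "\<tau> = \<delta> / (8 * (2 * B + 1))"
  have \<tau>: "0 < \<tau>" "\<tau> * (2 * B + 1) \<le> \<delta> / 8" using \<delta> B(1) by (simp_all add: \<tau>_def field_simps)
  have "(\<lambda>n. (1 / \<tau> + 1) * (\<Sum>j. a n j * (\<nu> n j)\<^sup>2)) \<longlonglongrightarrow> (1 / \<tau> + 1) * 0"
    by (intro tendsto_intros lim)
  then have ev1: "eventually (\<lambda>n. (1 / \<tau> + 1) * (\<Sum>j. a n j * (\<nu> n j)\<^sup>2) < \<delta> / 4) sequentially"
    using \<delta> by (intro order_tendstoD(2)) auto
  have "(\<lambda>n. 16 * sqrt C * (\<Sum>j. a n j * (\<nu> n j)\<^sup>2) / \<delta>\<^sup>2) \<longlonglongrightarrow> 16 * sqrt C * 0 / \<delta>\<^sup>2"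
    using \<delta> by (intro tendsto_intros lim) auto
  then have ev2: "eventually (\<lambda>n. 16 * sqrt C * (\<Sum>j. a n j * (\<nu> n j)\<^sup>2) / \<delta>\<^sup>2 < \<epsilon> / 2) sequentially"
    using \<open>0 < \<epsilon>\<close> by (intro order_tendstoD(2)) auto
  have ev3: "eventually (\<lambda>n. (\<Sum>j. a n j * (\<nu> n j)\<^sup>2) < 1 / 2) sequentially"
    by (intro order_tendstoD(2)[OF lim]) auto
  have "eventually (\<lambda>n. norm (centred_chi_sq_cdf (a n) (\<mu> n) (t n) - centred_chi_sq_cdf (a n) (\<lambda>j. \<mu> n j + \<nu> n j) (t n) - 0) < \<epsilon>) sequentially"
    using ev1 ev2 ev3 t eventually_ge_at_top[of 1]
  proof eventually_elim
    case (elim n)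
    note w = weights(1)[OF elim(5)] weights(2)[OF elim(5)] C(1) C(2)[OF elim(5)]
    note s\<mu> = \<mu>[OF elim(5)] and s\<nu> = \<nu>[OF elim(5)]
    note prod = summable_weighted_product[OF w(1,2) s\<mu> s\<nu>]
    note s_add = summable_shift_add[OF w(1,2) s\<mu> s\<nu>]
    define R where "R \<rho> = (\<Sum>j. a n j * (\<rho> j)\<^sup>2)" for \<rho>
    define P where "P = (\<Sum>j. a n j * (\<mu> n j * \<nu> n j))"
    have R_nonneg: "0 \<le> R (\<nu> n)" unfolding R_def using w(1) s\<nu> by (intro suminf_nonneg) auto
    have R_add: "R (\<lambda>j. \<mu> n j + \<nu> n j) = R (\<mu> n) + 2 * P + R (\<nu> n)"
    proof -
      have "(\<lambda>j. a n j * (\<mu> n j)\<^sup>2 + 2 * (a n j * (\<mu> n j * \<nu> n j)) + a n j * (\<nu> n j)\<^sup>2) sums (R (\<mu> n) + 2 * P + R (\<nu> n))"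
        unfolding R_def P_def using s\<mu> s\<nu> prod by (intro sums_add sums_mult summable_sums)
      then show ?thesis unfolding R_def by (simp add: sums_iff power2_eq_square algebra_simps)
    qed
    have P_le: "2 * \<bar>P\<bar> \<le> k * R (\<mu> n) + R (\<nu> n) / k" if "0 < k" for k
    proof -
      have sums: "(\<lambda>j. k * (a n j * (\<mu> n j)\<^sup>2) + a n j * (\<nu> n j)\<^sup>2 / k + 2 * s * (a n j * (\<mu> n j * \<nu> n j)))
          sums (k * R (\<mu> n) + R (\<nu> n) / k + 2 * s * P)" for s
        unfolding R_def P_def using s\<mu> s\<nu> prod by (intro sums_add sums_mult sums_divide summable_sums)
      \<comment> \<open>Both signs of the cross term are treated at once by \<open>s = 1\<close> and \<open>s = -1\<close>.\<close>
      have "0 \<le> k * R (\<mu> n) + R (\<nu> n) / k + 2 * s * P" if "s\<^sup>2 = 1" for s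
      proof (rule sums_le[OF _ sums_zero sums])
        fix j
        have "k * (a n j * (\<mu> n j)\<^sup>2) + a n j * (\<nu> n j)\<^sup>2 / k + 2 * s * (a n j * (\<mu> n j * \<nu> n j))
            = a n j * (k * \<mu> n j + s * \<nu> n j)\<^sup>2 / k"
          using \<open>0 < k\<close> that by (simp add: power2_sum power_mult_distrib field_simps power2_eq_square)
        then show "0 \<le> k * (a n j * (\<mu> n j)\<^sup>2) + a n j * (\<nu> n j)\<^sup>2 / k + 2 * s * (a n j * (\<mu> n j * \<nu> n j))"
          using w(1)[of j] \<open>0 < k\<close> by simp
      qed
      from this[of 1] this[of "-1"] show ?thesis by simp
    qed
    show ?case
    proof (cases "R (\<mu> n) < 2 * B + 1")
      case True
      have "2 * \<bar>P\<bar> \<le> \<delta> / 8 + R (\<nu> n) / \<tau>"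
        using P_le[OF \<tau>(1)] mult_left_mono[of "R (\<mu> n)" "2 * B + 1" \<tau>] True \<tau> by linarith
      moreover have "R (\<nu> n) / \<tau> + R (\<nu> n) < \<delta> / 4"
        using elim(1) by (simp add: R_def distrib_right)
      ultimately have "\<bar>2 * P + R (\<nu> n)\<bar> \<le> \<delta> / 2"
        using R_nonneg \<delta> by linarith
      then have "norm (centred_chi_sq_cdf (a n) (\<mu> n) (t n) - centred_chi_sq_cdf (a n) (\<lambda>j. \<mu> n j + \<nu> n j) (t n))
          \<le> exp (1 / 2) * (sqrt \<delta> + (1 + 4 * (\<Sum>j. (a n j)\<^sup>2) / \<delta>) powr (- 1 / 4))
            + 16 * sqrt C * R (\<nu> n) / \<delta>\<^sup>2"
        unfolding centred_chi_sq_cdf_def R_def P_def real_norm_def by (intro prob_chi_sq_shift_le w s\<mu> s\<nu> \<delta>)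
      then show ?thesis using ball[OF b(2)[OF elim(5)]] elim(2) by (simp add: R_def)
    next
      case False
      have "2 * \<bar>P\<bar> \<le> 1 / 2 * R (\<mu> n) + 2 * R (\<nu> n)" using P_le[of "1 / 2"] by simp
      then have big': "B \<le> R (\<lambda>j. \<mu> n j + \<nu> n j)"
        using R_add False elim(3) by (simp add: R_def[symmetric])
      have big: "B \<le> R (\<mu> n)" using False B(1) by simp
      have tail: "centred_chi_sq_cdf (a n) \<rho> (t n) \<le> \<epsilon> / 2" if "B \<le> R \<rho>" "summable (\<lambda>j. a n j * (\<rho> j)\<^sup>2)" for \<rho>
      proof -
        have "centred_chi_sq_cdf (a n) \<rho> (t n) \<le> D / R \<rho>"
          unfolding centred_chi_sq_cdf_def D_def R_def using that B elim(4)
          by (intro prob_chi_sq_lower_tail w) (auto simp: R_def)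
        also have "\<dots> \<le> D / B" using that B(1) \<open>0 \<le> D\<close> by (intro divide_left_mono) auto
        also note DB
        finally show ?thesis .
      qed
      have "0 \<le> centred_chi_sq_cdf (a n) (\<mu> n) (t n)" "0 \<le> centred_chi_sq_cdf (a n) (\<lambda>j. \<mu> n j + \<nu> n j) (t n)"
        by (simp_all add: centred_chi_sq_cdf_def)
      with tail[OF big s\<mu>] tail[OF big' s_add] show ?thesis
        using \<open>0 < \<epsilon>\<close> by (simp add: abs_less_iff)
    qed
  qed
  then show "\<exists>N. \<forall>n\<ge>N. norm (centred_chi_sq_cdf (a n) (\<mu> n) (t n) - centred_chi_sq_cdf (a n) (\<lambda>j. \<mu> n j + \<nu> n j) (t n) - 0) < \<epsilon>"
    by (simp add: eventually_sequentially)
qed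

end
end

section \<open>The white noise model\<close>

lemma square_integrable_product:
  assumes "g \<in> square_integrable" "h \<in> square_integrable"
  shows "integrable (lebesgue_on {0<..<1}) (\<lambda>t. g t * h t)"
    and "\<bar>L2_inner g h\<bar> \<le> L2_inner g g + L2_inner h h"
proof -
  let ?L = "lebesgue_on {0<..<1::real}"
  have [measurable]: "g \<in> borel_measurable ?L" "h \<in> borel_measurable ?L"
    and sq: "integrable ?L (\<lambda>t. (g t)\<^sup>2)" "integrable ?L (\<lambda>t. (h t)\<^sup>2)"
    using assms by (auto simp: square_integrable_def)
  have le: "\<bar>g t * h t\<bar> \<le> (g t)\<^sup>2 + (h t)\<^sup>2" for t
  proof -
    have "0 \<le> \<bar>g t\<bar> * \<bar>h t\<bar>" by simp
    with sum_squares_bound[of "\<bar>g t\<bar>" "\<bar>h t\<bar>"] show ?thesis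
      unfolding abs_mult power2_abs by linarith
  qed
  show int: "integrable ?L (\<lambda>t. g t * h t)"
    by (rule Bochner_Integration.integrable_bound[OF Bochner_Integration.integrable_add[OF sq]])
      (use le in \<open>auto simp: order_trans[OF le abs_ge_self]\<close>)
  have "\<bar>L2_inner g h\<bar> \<le> (LINT t|?L. (g t)\<^sup>2 + (h t)\<^sup>2)"
    unfolding L2_inner_def using int sq le
    by (intro order_trans[OF integral_abs_bound] integral_mono) auto
  then show "\<bar>L2_inner g h\<bar> \<le> L2_inner g g + L2_inner h h"
    using sq by (simp add: L2_inner_def power2_eq_square)
qed

lemma L2_inner_add_right:
  assumes "e \<in> square_integrable" "g \<in> square_integrable" "h \<in> square_integrable"
  shows "L2_inner e (\<lambda>t. g t + h t) = L2_inner e g + L2_inner e h"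
  using square_integrable_product(1)[OF assms(1,2)] square_integrable_product(1)[OF assms(1,3)]
  by (simp add: L2_inner_def distrib_left)

text \<open>
  Moves the independence of the noise coordinates from the index set \<open>{1..}\<close> to all natural numbers.
\<close>

lemma (in prob_space) indep_vars_reindex_inj:
  assumes "inj f" and indep: "indep_vars (\<lambda>_. N) X (range f)"
  shows "indep_vars (\<lambda>_. N) (\<lambda>j. X (f j)) UNIV"
  unfolding indep_vars_def2
proof (intro conjI ballI indep_setsI)
  let ?F = "\<lambda>i. {X i -` A \<inter> space M |A. A \<in> sets N}"
  have sets: "indep_sets ?F (range f)" using indep by (simp add: indep_vars_def2)
  show rv: "random_variable N (X (f j))" for j using indep by (simp add: indep_vars_def2)
  show "?F (f j) \<subseteq> events" for j using rv[of j] by (auto simp: measurable_sets)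
  fix A J
  assume J: "J \<noteq> {}" "finite J" and A: "\<forall>j\<in>J. A j \<in> ?F (f j)"
  have "prob (\<Inter>i\<in>f ` J. A (inv f i)) = (\<Prod>i\<in>f ` J. prob (A (inv f i)))"
    using J A \<open>inj f\<close> by (intro indep_setsD[OF sets]) auto
  then show "prob (\<Inter>j\<in>J. A j) = (\<Prod>j\<in>J. prob (A j))"
    using \<open>inj f\<close> by (simp add: prod.reindex inj_on_subset[OF \<open>inj f\<close>])
qed

theorem theorem4p7:
  fixes M :: "'a measure"
    and W :: "(real \<Rightarrow> real) \<Rightarrow> 'a \<Rightarrow> real"
    and \<phi> :: "nat \<Rightarrow> real \<Rightarrow> real"
    and \<kappa> :: "nat \<Rightarrow> nat \<Rightarrow> real"
    and r \<sigma> \<alpha> :: real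
    and f f1 :: "nat \<Rightarrow> real \<Rightarrow> real"
    and c :: "nat \<Rightarrow> real"
  assumes "0 < r" "r < 1/2" "0 < \<sigma>"
    and "gaussian_white_noise M W"
    and "orthonormal_basis \<phi>"
    and "assumption_A1 \<kappa>"
    and "assumption_A2 \<sigma> \<kappa>"
    and "assumption_A3 r \<kappa>"
    and "assumption_A4 \<kappa>"
    and "assumption_A5 \<kappa>"
    and "\<forall>n\<ge>1. f n \<in> square_integrable"
    and "consistent M W \<phi> \<kappa> \<sigma> f"
    and "\<forall>n\<ge>1. f1 n \<in> square_integrable"
    and "inconsistent M W \<phi> \<kappa> \<sigma> f1"
    and "0 < \<alpha>" "\<alpha> < 1"
    and "asymptotic_level M W \<phi> \<kappa> \<sigma> c \<alpha>"
  shows "(\<lambda>n. type_II_error M W \<phi> \<kappa> \<sigma> n (c n) (f n)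
              - type_II_error M W \<phi> \<kappa> \<sigma> n (c n) (\<lambda>t. f n t + f1 n t)) \<longlonglongrightarrow> 0"
proof -
  note \<sigma> = \<open>0 < \<sigma>\<close>
  have \<phi>: "\<phi> (Suc j) \<in> square_integrable" "L2_inner (\<phi> (Suc j)) (\<phi> (Suc j)) = 1" for j
    using \<open>orthonormal_basis \<phi>\<close> by (auto simp: orthonormal_basis_def orthonormal_def)
  have \<phi>_norm: "L2_norm (\<phi> (Suc j)) = 1" for j by (simp add: L2_norm_def \<phi>)
  interpret prob_space M using \<open>gaussian_white_noise M W\<close> by (simp add: gaussian_white_noise_def)
  define \<xi> where "\<xi> j = W (\<phi> (Suc j))" for j
  interpret std_normal_sequence M \<xi>
  proof
    have "indep_vars (\<lambda>_. borel) (\<lambda>j. W (\<phi> j)) {1..}"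
      using assms(4,5) by (simp add: gaussian_white_noise_def orthonormal_basis_def)
    moreover have "{1..} = range Suc" by (auto simp: image_iff) (metis Suc_le_D)
    ultimately have "indep_vars (\<lambda>_. borel) (\<lambda>j. W (\<phi> j)) (range Suc)" by simp
    from indep_vars_reindex_inj[OF inj_Suc this] show "indep_vars (\<lambda>_. borel) \<xi> UNIV"
      unfolding \<xi>_def .
    show "distributed M lborel (\<xi> j) std_normal_density" for j
      using \<open>gaussian_white_noise M W\<close> \<phi>[of j] \<phi>_norm[of j]
      unfolding gaussian_white_noise_def \<xi>_def by (metis zero_less_one)
  qed

  \<comment> \<open>Normalized weights and shifts; the factor \<open>s n\<close> takes the normalized statistic back to the
    original one.\<close>
  define a where "a n j = real n / \<sigma>\<^sup>2 * (\<kappa> n (Suc j))\<^sup>2" for n j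
  define shift where "shift n g j = sqrt (real n) / \<sigma> * L2_inner (\<phi> (Suc j)) g" for n g j
  define s where "s n = \<sigma> ^ 4 / (real n)\<^sup>2" for n
  have s_pos: "0 < s n" if "1 \<le> n" for n using that \<sigma> by (simp add: s_def)
  have a_nonneg: "0 \<le> a n j" for n j by (simp add: a_def)
  have \<kappa>_summable: "summable (\<lambda>j. (\<kappa> n (Suc j))\<^sup>2)" if "1 \<le> n" for n
    using \<open>assumption_A3 r \<kappa>\<close> that unfolding assumption_A3_def by blast
  have a_summable: "summable (a n)" if "1 \<le> n" for n
    unfolding a_def using \<kappa>_summable[OF that] by (rule summable_mult)
  obtain C1 C2 where C: "0 < C1" "0 < C2"
    and A: "\<And>n. 1 \<le> n \<Longrightarrow> summable (\<lambda>j. \<kappa> n (Suc j) ^ 4)"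
      "\<And>n. 1 \<le> n \<Longrightarrow> C1 < (real n)\<^sup>2 / \<sigma> ^ 4 * (\<Sum>j. \<kappa> n (Suc j) ^ 4)"
      "\<And>n. 1 \<le> n \<Longrightarrow> (real n)\<^sup>2 / \<sigma> ^ 4 * (\<Sum>j. \<kappa> n (Suc j) ^ 4) < C2"
    using \<open>assumption_A2 \<sigma> \<kappa>\<close> unfolding assumption_A2_def by blast
  have a_sq: "(\<Sum>j. (a n j)\<^sup>2) = (real n)\<^sup>2 / \<sigma> ^ 4 * (\<Sum>j. \<kappa> n (Suc j) ^ 4)" if "1 \<le> n" for n
  proof -
    have "(a n j)\<^sup>2 = (real n)\<^sup>2 / \<sigma> ^ 4 * \<kappa> n (Suc j) ^ 4" for j
      by (simp add: a_def power_mult_distrib power_divide)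
    then show ?thesis using A(1)[OF that] by (simp only: suminf_mult)
  qed
  have shift_summable: "summable (\<lambda>j. a n j * (shift n g j)\<^sup>2)" if "1 \<le> n" "g \<in> square_integrable" for n g
  proof (rule summable_comparison_test')
    \<comment> \<open>The weights are summable, so it is enough that the Fourier coefficients of \<open>g\<close> are bounded.\<close>
    define B where "B = sqrt (real n) / \<sigma> * (1 + L2_inner g g)"
    show "summable (\<lambda>j. B\<^sup>2 * a n j)" using a_summable[OF that(1)] by (rule summable_mult)
    fix j
    have "\<bar>shift n g j\<bar> \<le> B"
      using square_integrable_product(2)[OF \<phi>(1)[of j] that(2)] \<sigma>
      unfolding shift_def B_def abs_mult by (intro mult_mono) (auto simp: \<phi>(2))
    then have "\<bar>shift n g j\<bar>\<^sup>2 \<le> B\<^sup>2" by (rule power_mono) simp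
    then have "(shift n g j)\<^sup>2 \<le> B\<^sup>2" by simp
    then have "a n j * (shift n g j)\<^sup>2 \<le> a n j * B\<^sup>2" using a_nonneg by (rule mult_left_mono)
    then show "norm (a n j * (shift n g j)\<^sup>2) \<le> B\<^sup>2 * a n j" using a_nonneg by (simp add: mult.commute)
  qed

  \<comment> \<open>The identity needs convergence of the series, hence holds only almost surely.\<close>
  have T_eq: "AE \<omega> in M. T_stat \<kappa> \<sigma> n (\<lambda>j. Y_int W \<sigma> n g (\<phi> j) \<omega>) = s n * (chi_sq (a n) (shift n g) \<omega> - suminf (a n))"
    if "1 \<le> n" "summable (\<lambda>j. a n j * (shift n g j)\<^sup>2)" for n g
    using AE_summable_chi_sq[OF a_nonneg a_summable[OF that(1)] that(2)]
  proof eventually_elim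
    case (elim \<omega>)
    have "(\<kappa> n (Suc j))\<^sup>2 * (Y_int W \<sigma> n g (\<phi> (Suc j)) \<omega>)\<^sup>2 = s n * (a n j * (\<xi> j \<omega> + shift n g j)\<^sup>2)" for j
    proof -
      have "Y_int W \<sigma> n g (\<phi> (Suc j)) \<omega> = \<sigma> / sqrt (real n) * (\<xi> j \<omega> + shift n g j)"
        using \<sigma> that(1) by (simp add: Y_int_def shift_def \<xi>_def distrib_left)
      moreover have "s n * a n j = (\<kappa> n (Suc j))\<^sup>2 * (\<sigma> / sqrt (real n))\<^sup>2"
        using \<sigma> that(1) by (simp add: s_def a_def power_divide power2_eq_square power4_eq_xxxx)
      ultimately show ?thesis by (simp only: power_mult_distrib mult.assoc[symmetric])
    qed
    moreover have "\<sigma>\<^sup>2 / real n * rho \<kappa> n = s n * suminf (a n)"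
      unfolding a_def suminf_mult[OF \<kappa>_summable[OF that(1)]] rho_def
      using \<sigma> that(1) by (simp add: s_def power2_eq_square power4_eq_xxxx)
    ultimately show ?case
      unfolding T_stat_def chi_sq_def using elim by (simp only: suminf_mult right_diff_distrib)
  qed
  have T_meas [measurable]: "random_variable borel (\<lambda>\<omega>. T_stat \<kappa> \<sigma> n (\<lambda>j. Y_int W \<sigma> n g (\<phi> j) \<omega>))" for n g
    using measurable_xi unfolding T_stat_def Y_int_def \<xi>_def by measurable
  have II: "type_II_error M W \<phi> \<kappa> \<sigma> n u g = centred_chi_sq_cdf (a n) (shift n g) (u / s n)"
    if "1 \<le> n" "summable (\<lambda>j. a n j * (shift n g j)\<^sup>2)" for n u g
    unfolding type_II_error_def centred_chi_sq_cdf_def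
  proof (rule finite_measure_eq_AE)
    show "AE \<omega> in M. \<omega> \<in> {\<omega> \<in> space M. T_stat \<kappa> \<sigma> n (\<lambda>j. Y_int W \<sigma> n g (\<phi> j) \<omega>) \<le> u}
        \<longleftrightarrow> \<omega> \<in> {\<omega> \<in> space M. chi_sq (a n) (shift n g) \<omega> - suminf (a n) \<le> u / s n}"
      using T_eq[OF that] by eventually_elim (simp add: pos_le_divide_eq[OF s_pos[OF that(1)]] mult.commute)
  qed measurable
  have shift_zero: "shift n (\<lambda>_. 0) = (\<lambda>_. 0)" for n
    by (rule ext) (simp add: shift_def L2_inner_def)
  have I: "type_I_error M W \<phi> \<kappa> \<sigma> n u = 1 - centred_chi_sq_cdf (a n) (\<lambda>_. 0) (u / s n)" if "1 \<le> n" for n u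
  proof -
    have "type_I_error M W \<phi> \<kappa> \<sigma> n u = 1 - type_II_error M W \<phi> \<kappa> \<sigma> n u (\<lambda>_. 0)"
      unfolding type_I_error_def type_II_error_def
      by (subst prob_compl[symmetric]) (auto intro!: arg_cong[where f=prob])
    then show ?thesis using II[OF that, of "\<lambda>_. 0" u] by (simp add: shift_zero)
  qed

  have a_sq_bounds: "C1 \<le> (\<Sum>j. (a n j)\<^sup>2)" "(\<Sum>j. (a n j)\<^sup>2) \<le> C2" if "1 \<le> n" for n
    using A(2,3)[OF that] by (simp_all only: a_sq[OF that] less_imp_le)
  define t where "t n = c n / s n" for n
  have fs: "summable (\<lambda>j. a n j * (shift n (f n) j)\<^sup>2)" and f1s: "summable (\<lambda>j. a n j * (shift n (f1 n) j)\<^sup>2)"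
    if "1 \<le> n" for n
    using shift_summable that assms(11,13) by blast+

  have "(\<lambda>n. type_I_error M W \<phi> \<kappa> \<sigma> n (c n)) \<longlonglongrightarrow> \<alpha>"
    using tendsto_asymp_equiv_cong[OF \<open>asymptotic_level M W \<phi> \<kappa> \<sigma> c \<alpha>\<close>[unfolded asymptotic_level_def]]
    by simp
  then have "(\<lambda>n. 1 - type_I_error M W \<phi> \<kappa> \<sigma> n (c n)) \<longlonglongrightarrow> 1 - \<alpha>" by (intro tendsto_intros)
  then have "(\<lambda>n. centred_chi_sq_cdf (a n) (\<lambda>_. 0) (t n)) \<longlonglongrightarrow> 1 - \<alpha>"
    by (rule Lim_transform_eventually)
      (use eventually_ge_at_top[of 1] in \<open>eventually_elim, simp add: I t_def\<close>)
  then have t_le: "eventually (\<lambda>n. t n \<le> sqrt (4 * C2 / \<alpha>)) sequentially"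
    by (intro critical_values_eventually_le[where a=a and C=C2] a_nonneg a_summable C(2) a_sq_bounds(2) \<open>0 < \<alpha>\<close>)

  have f1_lim: "(\<lambda>n. \<Sum>j. a n j * (shift n (f1 n) j)\<^sup>2) \<longlonglongrightarrow> 0"
  proof (intro signal_tendsto_zero[where a=a and C=C2] a_nonneg a_summable C(2) a_sq_bounds(2) f1s)
    fix \<eta> :: real assume "0 < \<eta>"
    let ?gap = "\<lambda>n t. centred_chi_sq_cdf (a n) (\<lambda>_. 0) t - centred_chi_sq_cdf (a n) (shift n (f1 n)) t"
    \<comment> \<open>Inconsistency speaks of sequences of thresholds.  To make it uniform in the threshold, it is
      applied to a sequence which, for every \<open>n\<close> where a gap larger than \<open>\<eta>\<close> exists, exhibits one.\<close>
    define u where "u n = s n * (SOME t. \<eta> < ?gap n t)" for n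
    have "ereal (1 - \<eta>) < 1" using \<open>0 < \<eta>\<close> by simp
    also have "1 \<le> liminf (\<lambda>n. ereal (type_I_error M W \<phi> \<kappa> \<sigma> n (u n) + type_II_error M W \<phi> \<kappa> \<sigma> n (u n) (f1 n)))"
      using \<open>inconsistent M W \<phi> \<kappa> \<sigma> f1\<close> by (simp add: inconsistent_def)
    finally have "eventually (\<lambda>n. ereal (1 - \<eta>) < ereal (type_I_error M W \<phi> \<kappa> \<sigma> n (u n) + type_II_error M W \<phi> \<kappa> \<sigma> n (u n) (f1 n))) sequentially"
      by (rule less_LiminfD)
    then show "eventually (\<lambda>n. \<forall>t. ?gap n t \<le> \<eta>) sequentially"
      using eventually_ge_at_top[of 1]
    proof eventually_elim
      case (elim n)
      have "?gap n (SOME t. \<eta> < ?gap n t) < \<eta>"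
        using elim I[OF elim(2)] II[OF elim(2) f1s[OF elim(2)]] s_pos[OF elim(2)] by (simp add: u_def)
      then have below: "\<not> \<eta> < ?gap n (SOME t. \<eta> < ?gap n t)" by simp
      show ?case
      proof (intro allI, rule ccontr)
        fix t assume "\<not> ?gap n t \<le> \<eta>"
        then have "\<eta> < ?gap n t" by simp
        then have "\<eta> < ?gap n (SOME t. \<eta> < ?gap n t)" by (rule someI)
        with below show False by (rule notE)
      qed
    qed
  qed
  have lim: "(\<lambda>n. centred_chi_sq_cdf (a n) (shift n (f n)) (t n)
      - centred_chi_sq_cdf (a n) (\<lambda>j. shift n (f n) j + shift n (f1 n) j) (t n)) \<longlonglongrightarrow> 0"
    by (rule centred_chi_sq_cdf_shift_tendsto_zero[where a=a and C=C2 and b=C1, OF _ _ C(2) _ C(1) _ _ _ t_le f1_lim])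
      (simp_all add: a_nonneg a_summable a_sq_bounds fs f1s)
  show ?thesis
  proof (rule Lim_transform_eventually[OF lim])
    show "eventually (\<lambda>n. centred_chi_sq_cdf (a n) (shift n (f n)) (t n)
        - centred_chi_sq_cdf (a n) (\<lambda>j. shift n (f n) j + shift n (f1 n) j) (t n)
      = type_II_error M W \<phi> \<kappa> \<sigma> n (c n) (f n)
        - type_II_error M W \<phi> \<kappa> \<sigma> n (c n) (\<lambda>t. f n t + f1 n t)) sequentially"
      using eventually_ge_at_top[of 1]
    proof eventually_elim
      case (elim n)
      have "shift n (\<lambda>t. f n t + f1 n t) = (\<lambda>j. shift n (f n) j + shift n (f1 n) j)"
        using assms(11,13) elim by (intro ext) (simp add: shift_def L2_inner_add_right \<phi>(1) distrib_left)
      moreover have "summable (\<lambda>j. a n j * (shift n (f n) j + shift n (f1 n) j)\<^sup>2)"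
        using elim by (intro summable_shift_add a_nonneg a_summable fs f1s)
      ultimately show ?case using elim by (simp add: II fs t_def)
    qed
  qed
qed

end
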